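(* Let $\mathcal{G}$ be a finite simple graph with vertex set $I=\{1,\dots,n\}$, and let $I(\mathcal{G},\mathbf{x})\in R=\mathbb{Q}[[x_i : i\in I]]$ be its multi-variate independence polynomial. Then the following statements are equivalent. (1) The graph $\mathcal{G}$ is chordal. (2) The power series $I(\mathcal{G},\mathbf{x})^{-q}$ is Horn hypergeometric for all integers $q\ge 1$. (3) The power series $I(\mathcal{G},\mathbf{x})^{-1}$ is Horn hypergeometric.
   Context: All graphs are finite and simple (no loops, no multiple edges). A subset $S\subseteq I$ is independent if the subgraph induced on $S$ has no edges; $\mathcal{I}(\mathcal{G})$ is the set of all independent subsets (including $\emptyset$ and all singletons). The multi-variate independence polynomial is $I(\mathcal{G},\mathbf{x})=\sum_{S\in\mathcal{I}(\mathcal{G})}\prod_{i\in S}x_i\in R=\mathbb{Q}[[x_i : i\in I]]$ (commuting variables). It has constant term $1$, so it is invertible in $R$ and $I(\mathcal{G},\mathbf{x})^{-q}\in R$ for every $q\geq 1$. A graph is chordal if it has no induced subgraph isomorphic to the cycle graph $C_m$ for any $m\ge 4$, where $C_m$ has vertices $1,\dots,m$ with $i$ joined to $i+1$ (indices modulo $m$). For an $I$-tuple of integers $\mathbf{m}=(m_i : i\in I)$, $\mathrm{supp}(\mathbf{m})=\{i\in I : m_i\ne 0\}$; $\mathbf{m}\ge 0$ means $m_i\ge 0$ for all $i$; $\mathbf{x}^{\mathbf{m}}=\prod_{i\in I}x_i^{m_i}$; $\mathbf{e}_i=(\delta_{ji} : j\in I)$. A power series $F(\mathbf{x})=\sum_{\mathbf{m}\ge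 0}c_{\mathbf{m}}\mathbf{x}^{\mathbf{m}}\in R$ is called Horn hypergeometric if (i) $c_{\mathbf{m}}\neq 0$ for all $\mathbf{m}\ge 0$, and (ii) $c_{\mathbf{m}+\mathbf{e}_i}/c_{\mathbf{m}}$ is a rational function of $\{m_j : j\in\mathrm{supp}(\mathbf{m})\}$ for each $i\in\mathrm{supp}(\mathbf{m})$; that is, for every $J\subseteq I$ and $i\in J$ there is a rational function over $\mathbb{Q}$ in the variables $m_j$ ($j\in J$) whose value at $\mathbf{m}$ is defined and equal to $c_{\mathbf{m}+\mathbf{e}_i}/c_{\mathbf{m}}$ for all $\mathbf{m}\ge 0$ with $\mathrm{supp}(\mathbf{m})=J$. *)

theory Defs
  imports
    "HOL-Library.Poly_Mapping"
    "Graph_Theory.Pair_Digraph"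
    "Graph_Theory.Digraph_Component"
    "Graph_Theory.Digraph_Isomorphism"
begin

section \<open>Multivariate power series\<close>

text \<open>
  Exponent vectors are finitely supported maps \<^typ>\<open>'v \<Rightarrow>\<^sub>0 nat\<close>, so that
  \<^const>\<open>Poly_Mapping.keys\<close> is the support of an exponent vector. A power series is an arbitrary
  family of coefficients indexed by exponent vectors.
\<close>

typedef ('v, 'a) mfps = "UNIV :: (('v \<Rightarrow>\<^sub>0 nat) \<Rightarrow> 'a) set"
  morphisms mcoeff Abs_mfps ..

setup_lifting type_definition_mfps

lemma mfps_eqI: "(\<And>m. mcoeff F m = mcoeff G m) \<Longrightarrow> F = G"
  by (simp add: mcoeff_inject[symmetric] fun_eq_iff)

lemma finite_splits: "finite {(a, b). a + b = (m :: 'v \<Rightarrow>\<^sub>0 nat)}"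
proof -
  let ?B = "{a. \<forall>i. Poly_Mapping.lookup a i \<le> Poly_Mapping.lookup m i}"
  let ?N = "\<Sum>i\<in>Poly_Mapping.keys m. Poly_Mapping.lookup m i"
  have "Poly_Mapping.lookup ` ?B \<subseteq>
    {f. \<forall>i. (i \<in> Poly_Mapping.keys m \<longrightarrow> f i \<in> {..?N}) \<and> (i \<notin> Poly_Mapping.keys m \<longrightarrow> f i = 0)}"
  proof clarsimp
    fix a :: "'v \<Rightarrow>\<^sub>0 nat" and i
    assume le: "\<forall>i. Poly_Mapping.lookup a i \<le> Poly_Mapping.lookup m i"
    have "Poly_Mapping.lookup m i \<le> ?N" if "i \<in> Poly_Mapping.keys m"
      using that by (intro member_le_sum) auto
    moreover have "Poly_Mapping.lookup a i = 0" if "i \<notin> Poly_Mapping.keys m"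
      using le that by (metis in_keys_iff le_zero_eq)
    ultimately show "(i \<in> Poly_Mapping.keys m \<longrightarrow> Poly_Mapping.lookup a i \<le> ?N) \<and>
        (i \<notin> Poly_Mapping.keys m \<longrightarrow> Poly_Mapping.lookup a i = 0)"
      using le le_trans by blast
  qed
  moreover have "finite {f. \<forall>i. (i \<in> Poly_Mapping.keys m \<longrightarrow> f i \<in> {..?N}) \<and> (i \<notin> Poly_Mapping.keys m \<longrightarrow> f i = (0::nat))}"
    by (intro finite_set_of_finite_funs) auto
  ultimately have "finite (Poly_Mapping.lookup ` ?B)"
    using finite_subset by blast
  then have "finite ?B"
    by (rule finite_imageD) (simp add: lookup_inject inj_on_def)
  then have "finite (?B \<times> ?B)" by simp
  then show ?thesis
    by (rule rev_finite_subset) (auto simp: lookup_add)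
qed

instantiation mfps :: (type, comm_ring_1) comm_ring_1
begin

lift_definition zero_mfps :: "('a, 'b) mfps" is "\<lambda>m. 0" .
lift_definition one_mfps :: "('a, 'b) mfps" is "\<lambda>m. if m = 0 then 1 else 0" .
lift_definition plus_mfps :: "('a, 'b) mfps \<Rightarrow> ('a, 'b) mfps \<Rightarrow> ('a, 'b) mfps"
  is "\<lambda>F G m. F m + G m" .
lift_definition minus_mfps :: "('a, 'b) mfps \<Rightarrow> ('a, 'b) mfps \<Rightarrow> ('a, 'b) mfps"
  is "\<lambda>F G m. F m - G m" .
lift_definition uminus_mfps :: "('a, 'b) mfps \<Rightarrow> ('a, 'b) mfps"
  is "\<lambda>F m. - F m" .
lift_definition times_mfps :: "('a, 'b) mfps \<Rightarrow> ('a, 'b) mfps \<Rightarrow> ('a, 'b) mfps"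
  is "\<lambda>F G m. \<Sum>(a, b) | a + b = m. F a * G b" .

instance
proof
  fix F G H :: "('a, 'b) mfps"
  show "F * G * H = F * (G * H)"
  proof (rule mfps_eqI)
    fix m
    have "mcoeff (F * G * H) m =
        (\<Sum>p | fst p + snd p = m. \<Sum>q | fst q + snd q = fst p.
          mcoeff F (fst q) * mcoeff G (snd q) * mcoeff H (snd p))"
      by (simp add: times_mfps.rep_eq case_prod_unfold sum_distrib_right)
    also have "\<dots> = (\<Sum>x \<in> (SIGMA p:{p. fst p + snd p = m}. {q. fst q + snd q = fst p}).
        mcoeff F (fst (snd x)) * mcoeff G (snd (snd x)) * mcoeff H (snd (fst x)))"
      using finite_splits[where 'v='a]
      by (subst sum.Sigma) (auto simp: case_prod_unfold)
    also have "\<dots> = (\<Sum>x \<in> (SIGMA p:{p. fst p + snd p = m}. {q. fst q + snd q = snd p}).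
        mcoeff F (fst (fst x)) * (mcoeff G (fst (snd x)) * mcoeff H (snd (snd x))))"
      by (rule sum.reindex_bij_witness
            [where i = "\<lambda>((a, _), (b, c)). ((a + b, c), (a, b))"
               and j = "\<lambda>((_, c), (a, b)). ((a, b + c), (b, c))"])
         (auto simp: mult.assoc add.assoc)
    also have "\<dots> = (\<Sum>p | fst p + snd p = m. \<Sum>q | fst q + snd q = snd p.
          mcoeff F (fst p) * (mcoeff G (fst q) * mcoeff H (snd q)))"
      using finite_splits[where 'v='a]
      by (subst sum.Sigma) (auto simp: case_prod_unfold)
    also have "\<dots> = mcoeff (F * (G * H)) m"
      by (simp add: times_mfps.rep_eq case_prod_unfold sum_distrib_left)
    finally show "mcoeff (F * G * H) m = mcoeff (F * (G * H)) m" .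
  qed
  show "F * G = G * F"
  proof (rule mfps_eqI)
    fix m
    show "mcoeff (F * G) m = mcoeff (G * F) m"
      unfolding times_mfps.rep_eq
      by (rule sum.reindex_bij_witness[where i = prod.swap and j = prod.swap])
         (auto simp: add.commute mult.commute)
  qed
  show "1 * F = F"
  proof (rule mfps_eqI)
    fix m
    have "mcoeff (1 * F) m = (\<Sum>p | fst p + snd p = m. mcoeff 1 (fst p) * mcoeff F (snd p))"
      by (simp add: times_mfps.rep_eq case_prod_unfold)
    also have "\<dots> = (\<Sum>p\<in>{(0, m)}. mcoeff 1 (fst p) * mcoeff F (snd p))"
      using finite_splits[of m]
      by (intro sum.mono_neutral_right) (auto simp: one_mfps.rep_eq case_prod_unfold)
    finally show "mcoeff (1 * F) m = mcoeff F m"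
      by (simp add: one_mfps.rep_eq)
  qed
  show "(F + G) * H = F * H + G * H"
    by (rule mfps_eqI)
       (simp add: times_mfps.rep_eq plus_mfps.rep_eq case_prod_unfold distrib_right sum.distrib)
  show "(0 :: ('a, 'b) mfps) \<noteq> 1"
    by (metis one_mfps.rep_eq zero_mfps.rep_eq zero_neq_one)
qed (rule mfps_eqI; simp add: plus_mfps.rep_eq minus_mfps.rep_eq uminus_mfps.rep_eq
      zero_mfps.rep_eq algebra_simps)+

end

definition total_degree :: "('v \<Rightarrow>\<^sub>0 nat) \<Rightarrow> nat" where
  "total_degree m = (\<Sum>i\<in>Poly_Mapping.keys m. Poly_Mapping.lookup m i)"

lemma total_degree_add: "total_degree (a + b) = total_degree a + total_degree b"
proof -
  let ?K = "Poly_Mapping.keys a \<union> Poly_Mapping.keys b"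
  have "total_degree c = (\<Sum>i\<in>?K. Poly_Mapping.lookup c i)" if "Poly_Mapping.keys c \<subseteq> ?K" for c
    unfolding total_degree_def
    using that by (intro sum.mono_neutral_left) (auto simp: in_keys_iff)
  then show ?thesis
    by (simp add: keys_add lookup_add sum.distrib)
qed

lemma total_degree_pos: "m \<noteq> 0 \<Longrightarrow> total_degree m > 0"
  by (auto simp: total_degree_def in_keys_iff poly_mapping_eq_iff fun_eq_iff intro!: sum_pos)

function inverse_coeff :: "(('v \<Rightarrow>\<^sub>0 nat) \<Rightarrow> 'a::field) \<Rightarrow> ('v \<Rightarrow>\<^sub>0 nat) \<Rightarrow> 'a" where
  "inverse_coeff c m =
    (if m = 0 then inverse (c 0)
     else - inverse (c 0) * (\<Sum>p | fst p + snd p = m \<and> fst p \<noteq> 0.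
       c (fst p) * inverse_coeff c (snd p)))"
  by pat_completeness auto
termination
  by (relation "measure (total_degree \<circ> snd)") (auto simp: total_degree_add total_degree_pos)

declare inverse_coeff.simps [simp del]

instantiation mfps :: (type, field) inverse
begin

lift_definition inverse_mfps :: "('a, 'b) mfps \<Rightarrow> ('a, 'b) mfps" is inverse_coeff .
definition divide_mfps :: "('a, 'b) mfps \<Rightarrow> ('a, 'b) mfps \<Rightarrow> ('a, 'b) mfps" where
  "divide_mfps F G = F * inverse G"

instance ..

end

lemma mfps_right_inverse:
  fixes F :: "('v, 'a::field) mfps"
  assumes "mcoeff F 0 \<noteq> 0"
  shows "F * inverse F = 1"
proof (rule mfps_eqI)
  fix m :: "'v \<Rightarrow>\<^sub>0 nat"
  let ?t = "\<lambda>p. mcoeff F (fst p) * mcoeff (inverse F) (snd p)"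
  let ?A = "{p. fst p + snd p = m \<and> fst p \<noteq> 0}"
  have fin: "finite ?A"
    using finite_splits[of m] by (rule rev_finite_subset) auto
  have "{p. fst p + snd p = m} = insert (0, m) ?A"
    by (auto simp: prod_eq_iff)
  then have "mcoeff (F * inverse F) m = ?t (0, m) + sum ?t ?A"
    using fin by (simp add: times_mfps.rep_eq case_prod_unfold)
  also have "\<dots> = (if m = 0 then 1 else 0)"
  proof (cases "m = 0")
    case True
    have "a = 0" if "a + b = 0" for a b :: "'v \<Rightarrow>\<^sub>0 nat"
      using that by (auto simp: poly_mapping_eq_iff fun_eq_iff lookup_add)
    then have empty: "?A = {}" using True by auto
    show ?thesis
      unfolding empty
      using True assms by (simp add: inverse_mfps.rep_eq inverse_coeff.simps[of _ 0])
  next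
    case False
    then show ?thesis
      using assms by (simp add: inverse_mfps.rep_eq inverse_coeff.simps[of _ m])
  qed
  finally show "mcoeff (F * inverse F) m = mcoeff 1 m"
    by (simp add: one_mfps.rep_eq)
qed

lift_definition mfps_X :: "'v \<Rightarrow> ('v, 'a::comm_ring_1) mfps"
  is "\<lambda>i m. if m = Poly_Mapping.single i 1 then 1 else 0" .

text \<open>The power series in the variables indexed by \<open>I\<close>.\<close>

definition mfps_in :: "'v set \<Rightarrow> ('v, 'a::zero) mfps set" where
  "mfps_in I = {F. \<forall>m. \<not> Poly_Mapping.keys m \<subseteq> I \<longrightarrow> mcoeff F m = 0}"


section \<open>Horn hypergeometric series\<close>

text \<open>Multivariate polynomials are finitely supported maps from exponent vectors to coefficients.\<close>

definition polys_in :: "'v set \<Rightarrow> (('v \<Rightarrow>\<^sub>0 nat) \<Rightarrow>\<^sub>0 'a::zero) set" where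
  "polys_in J = {P. \<forall>a \<in> Poly_Mapping.keys P. Poly_Mapping.keys a \<subseteq> J}"

definition mpoly_eval :: "(('v \<Rightarrow>\<^sub>0 nat) \<Rightarrow>\<^sub>0 'a::comm_ring_1) \<Rightarrow> ('v \<Rightarrow> 'a) \<Rightarrow> 'a" where
  "mpoly_eval P x = (\<Sum>a\<in>Poly_Mapping.keys P.
     Poly_Mapping.lookup P a * (\<Prod>j\<in>Poly_Mapping.keys a. x j ^ Poly_Mapping.lookup a j))"

text \<open>
  The rational function is \<open>P / Q\<close>; its value is required to be defined at every \<open>m\<close> with
  support \<open>J\<close>. Such \<open>m\<close> exist for finite \<open>J\<close>, hence \<open>Q\<close> is not the zero polynomial.
\<close>

definition horn_hypergeometric :: "'v set \<Rightarrow> ('v, rat) mfps \<Rightarrow> bool" where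
  "horn_hypergeometric I F \<longleftrightarrow>
    F \<in> mfps_in I \<and>
    (\<forall>m. Poly_Mapping.keys m \<subseteq> I \<longrightarrow> mcoeff F m \<noteq> 0) \<and>
    (\<forall>J \<subseteq> I. \<forall>i \<in> J. \<exists>P \<in> polys_in J. \<exists>Q \<in> polys_in J.
      \<forall>m. Poly_Mapping.keys m = J \<longrightarrow>
        mpoly_eval Q (\<lambda>j. of_nat (Poly_Mapping.lookup m j)) \<noteq> 0 \<and>
        mcoeff F (m + Poly_Mapping.single i 1) / mcoeff F m =
          mpoly_eval P (\<lambda>j. of_nat (Poly_Mapping.lookup m j)) /
          mpoly_eval Q (\<lambda>j. of_nat (Poly_Mapping.lookup m j)))"


section \<open>Graphs\<close>

text \<open>
  A finite simple graph is a \<^const>\<open>pair_graph\<close>: a finite loopless digraph without parallel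
  arcs whose arc relation is symmetric, each edge being represented by its two orientations.
\<close>

definition cycle_graph :: "nat \<Rightarrow> nat pair_pre_digraph" where
  "cycle_graph m = \<lparr> pverts = {1..m},
     parcs = {(i, j). i \<in> {1..m} \<and> j \<in> {1..m} \<and>
                      (j mod m = (i + 1) mod m \<or> i mod m = (j + 1) mod m)} \<rparr>"

definition chordal :: "'v pair_pre_digraph \<Rightarrow> bool" where
  "chordal G \<longleftrightarrow>
    \<not> (\<exists>m\<ge>4. \<exists>H. induced_subgraph H (with_proj G) \<and> digraph_iso H (with_proj (cycle_graph m)))"

definition independent_sets :: "'v pair_pre_digraph \<Rightarrow> 'v set set" where
  "independent_sets G = {S. S \<subseteq> pverts G \<and> arcs (with_proj G \<restriction> S) = {}}"

definition independence_poly :: "'v pair_pre_digraph \<Rightarrow> ('v, rat) mfps" where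
  "independence_poly G = (\<Sum>S \<in> independent_sets G. \<Prod>i\<in>S. mfps_X i)"

end

theory Submission
  imports Defs
    "HOL-Library.FuncSet"
    "HOL-Computational_Algebra.Fundamental_Theorem_Algebra"
    "HOL-Computational_Algebra.Polynomial_Factorial"
    "HOL-Computational_Algebra.Field_as_Ring"
begin

text \<open>
  If the graph is chordal, order the vertices so that each is simplicial among the later ones. Then
  the coefficient of $x^m$ in $I^{-q}$ is the product over the vertices $v$ of the binomial
  coefficients of $-q - \sum_u m_u$ over $m_v$, where $u$ runs over the later neighbours of $v$; its
  term ratios are visibly rational and it never vanishes.

  Conversely, suppose the graph contains an induced cycle of length $n \ge 4$, and let $D(m)$ be the
  absolute values of the coefficients of $I^{-1}$ with support on that cycle. They are
  supermultiplicative and invariant under rotation, so $D(k, \ldots, k)$ grows, up to powers of $k$,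
  like $\mu^k$ with $\mu = z^{-n}$, where $z = (2\cos(\pi/2n))^{-2}$ and $-z$ is the root
  closest to $0$ of the univariate independence polynomial of the cycle. If the series were Horn hypergeometric,
  $D(k+1, \ldots, k+1) / D(k, \ldots, k)$ would be a rational function of $k$ over the rationals, and
  $\mu$ would be rational. It is not, since that would force $2\cos(\pi/n)$ to be an integer.
\<close>

section \<open>From chordality to explicit nonvanishing coefficients with rational ratios\<close>

section \<open>Chordal graphs and perfect elimination orderings\<close>

text \<open>The coefficient of a monomial in the inverse of I(G,-x) counts words with that content
  up to commutation of nonadjacent letters (Cartier and Foata). So for q = 1 nonvanishing never
  fails, and only rationality of the ratios can be an obstacle. The diagonal of a cycle is chosen
  because rotation fixes it. Setting all variables equal to t gives 1/I(C_n,-t), whose pole at z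
  governs the sum of \<open>D\<close> over degree k, and rotation carries this rate to the diagonal:
  some vector of degree k attains at least the average of polynomially many terms, and its n
  rotations add up to (k,...,k), so supermultiplicativity bounds the diagonal from below. From above
  it is one nonnegative term of the sum in degree nk. Polynomial losses are harmless, because a
  rational ratio compatible with exponential growth must converge, and its limit is a quotient of
  leading coefficients. The restriction n >= 4 is sharp: a triangle has \<mu> = (2 cos(pi/6))^6 =
  27, in accordance with the multinomials (3k)!/(k!)^3.\<close>

definition cycle_adj :: "nat \<Rightarrow> nat \<Rightarrow> nat \<Rightarrow> bool" where
  "cycle_adj n i j \<longleftrightarrow> i < n \<and> j < n \<and> (j = (i + 1) mod n \<or> i = (j + 1) mod n)"

definition induced_cycle :: "('v \<Rightarrow> 'v \<Rightarrow> bool) \<Rightarrow> 'v set \<Rightarrow> nat \<Rightarrow> (nat \<Rightarrow> 'v) \<Rightarrow> bool" where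
  "induced_cycle E V n f \<longleftrightarrow> inj_on f {..<n} \<and> f ` {..<n} \<subseteq> V \<and>
     (\<forall>i<n. \<forall>j<n. E (f i) (f j) \<longleftrightarrow> cycle_adj n i j)"

text \<open>Relation and vertex set are separate parameters, so that passing to an induced subgraph
  only shrinks \<open>V\<close>.\<close>

definition chordal_on :: "('v \<Rightarrow> 'v \<Rightarrow> bool) \<Rightarrow> 'v set \<Rightarrow> bool" where
  "chordal_on E V \<longleftrightarrow> (\<forall>n\<ge>4. \<forall>f. \<not> induced_cycle E V n f)"

definition simplicial :: "('v \<Rightarrow> 'v \<Rightarrow> bool) \<Rightarrow> 'v set \<Rightarrow> 'v \<Rightarrow> bool" where
  "simplicial E V v \<longleftrightarrow> (\<forall>a\<in>V. \<forall>b\<in>V. E v a \<longrightarrow> E v b \<longrightarrow> a \<noteq> b \<longrightarrow> E a b)"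

lemma chordal_on_subset: "chordal_on E V \<Longrightarrow> W \<subseteq> V \<Longrightarrow> chordal_on E W"
  unfolding chordal_on_def induced_cycle_def by (meson subset_trans)

lemma cycle_adj_iff:
  assumes "n \<ge> 3" "i < j" "j < n"
  shows "cycle_adj n i j \<longleftrightarrow> j = Suc i \<or> (i = 0 \<and> j = n - 1)"
  using assms unfolding cycle_adj_def by (cases "Suc j = n") auto

lemma cycle_adj_sym: "cycle_adj n i j \<longleftrightarrow> cycle_adj n j i"
  unfolding cycle_adj_def by auto

lemma cycle_adj_irrefl: "n \<ge> 2 \<Longrightarrow> \<not> cycle_adj n i i"
  unfolding cycle_adj_def by (cases "Suc i = n") auto

section \<open>Shortest paths and Dirac's theorem on simplicial vertices\<close>

lemma relpow_shortcut:
  assumes "\<And>i. i < L \<Longrightarrow> (f i, f (Suc i)) \<in> T" "i \<le> j" "j \<le> L"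
  shows "(f i, f j) \<in> T ^^ (j - i)"
proof -
  have "(f i, f (i + d)) \<in> T ^^ d" if "i + d \<le> L" for d
    using that
  proof (induction d)
    case (Suc d)
    then show ?case using assms(1)[of "i + d"] by auto
  qed simp
  from this[of "j - i"] show ?thesis using assms by simp
qed

lemma shortest_path_induced:
  assumes "(x, y) \<in> T\<^sup>*"
  obtains L f where "f 0 = x" "f L = y" "inj_on f {..L}"
    "\<And>i. i < L \<Longrightarrow> (f i, f (Suc i)) \<in> T"
    "\<And>i j. i < j \<Longrightarrow> j \<le> L \<Longrightarrow> (f i, f j) \<in> T \<Longrightarrow> j = Suc i"
proof -
  define L where "L = (LEAST n. (x, y) \<in> T ^^ n)"
  have ex: "\<exists>n. (x, y) \<in> T ^^ n"
    using assms by (simp add: rtrancl_power)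
  have L: "(x, y) \<in> T ^^ L"
    unfolding L_def using ex by (rule LeastI_ex)
  have min: "L \<le> n" if "(x, y) \<in> T ^^ n" for n
    unfolding L_def using that by (rule Least_le)
  obtain f where f: "f 0 = x" "f L = y" "\<And>i. i < L \<Longrightarrow> (f i, f (Suc i)) \<in> T"
    using L unfolding relpow_fun_conv by blast
  \<comment> \<open>Replacing the stretch from \<open>f i\<close> to \<open>f j\<close> by
    \<open>d\<close> steps cannot beat the minimum. The case \<open>d = 0\<close> yields
    injectivity, \<open>d = 1\<close> the absence of chords.\<close>
  have cut: "j \<le> i + d" if "i \<le> j" "j \<le> L" "(f i, f j) \<in> T ^^ d" for i j d
  proof -
    have "(x, f i) \<in> T ^^ i" using relpow_shortcut[of L f T 0 i] f that by auto
    moreover have "(f j, y) \<in> T ^^ (L - j)" using relpow_shortcut[of L f T j L] f that by auto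
    ultimately have "(x, y) \<in> T ^^ (i + d + (L - j))"
      using that(3) unfolding relpow_add by blast
    from min[OF this] show ?thesis using that by linarith
  qed
  have "f i \<noteq> f j" if "i < j" "j \<le> L" for i j
    using cut[of i j 0] that by auto
  then have "inj_on f {..L}"
    unfolding inj_on_def by (metis atMost_iff linorder_neqE_nat)
  moreover have "j = Suc i" if "i < j" "j \<le> L" "(f i, f j) \<in> T" for i j
    using cut[of i j 1] that by auto
  ultimately show ?thesis using that f by blast
qed

text \<open>Otherwise a shortest path from \<open>x\<close> to \<open>y\<close> through
  \<open>C\<close>, closed up by \<open>v\<close>, would be a chordless cycle: \<open>v\<close> sees
  no vertex of \<open>C\<close>, so its only neighbours on the path are the two ends.\<close>

lemma chordal_separator_clique:
  assumes ch: "chordal_on E V" and sym: "\<And>a b. E a b \<Longrightarrow> E b a" and irr: "\<And>a. \<not> E a a"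
    and C: "C \<subseteq> V" "\<And>c. c \<in> C \<Longrightarrow> \<not> E v c" "v \<notin> C" "v \<in> V"
    and conn: "\<And>a b. a \<in> C \<Longrightarrow> b \<in> C \<Longrightarrow> (a, b) \<in> {(a, b). E a b \<and> a \<in> C \<and> b \<in> C}\<^sup>*"
    and x: "x \<in> V" "E v x" "c1 \<in> C" "E x c1"
    and y: "y \<in> V" "E v y" "c2 \<in> C" "E y c2" and "x \<noteq> y"
  shows "E x y"
proof (rule ccontr)
  assume nE: "\<not> E x y"
  define W where "W = insert x (insert y C)"
  define T where "T = {(a, b). E a b \<and> a \<in> W \<and> b \<in> W}"
  have "{(a, b). E a b \<and> a \<in> C \<and> b \<in> C} \<subseteq> T" by (auto simp: T_def W_def)
  then have "(c1, c2) \<in> T\<^sup>*" using conn[OF x(3) y(3)] rtrancl_mono by blast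
  moreover have "(x, c1) \<in> T" "(c2, y) \<in> T" using x y sym by (auto simp: T_def W_def)
  ultimately have "(x, y) \<in> T\<^sup>*" by (meson converse_rtrancl_into_rtrancl rtrancl.rtrancl_into_rtrancl)
  then obtain L f where f: "f 0 = x" "f L = y" "inj_on f {..L}"
    "\<And>i. i < L \<Longrightarrow> (f i, f (Suc i)) \<in> T"
    "\<And>i j. i < j \<Longrightarrow> j \<le> L \<Longrightarrow> (f i, f j) \<in> T \<Longrightarrow> j = Suc i"
    by (rule shortest_path_induced) blast
  have "L \<noteq> 0" using f \<open>x \<noteq> y\<close> by metis
  moreover have "L \<noteq> 1" using f(4)[of 0] f(1,2) nE by (auto simp: T_def)
  ultimately have L: "L \<ge> 2" by linarith
  have fW: "f i \<in> W" if "i \<le> L" for i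
    using f(4)[of i] f(4)[of "i - 1"] that L by (cases "i = L") (auto simp: T_def)
  have fC: "f i \<in> C" if "0 < i" "i < L" for i
  proof -
    have "f i \<noteq> f 0" "f i \<noteq> f L" using f(3) that inj_onD by fastforce+
    then show ?thesis using fW[of i] f that by (auto simp: W_def)
  qed
  have fv: "f i \<noteq> v" if "i \<le> L" for i
    using fW[OF that] C(3) x(2) y(2) irr by (auto simp: W_def)
  have vE: "E v (f i) \<longleftrightarrow> i = 0 \<or> i = L" if "i \<le> L" for i
    using that fC[of i] C(2) f(1,2) x y by (cases "i = 0 \<or> i = L") auto
  have Ef: "E (f i) (f j) \<longleftrightarrow> j = Suc i" if "i < j" "j \<le> L" for i j
    using f(4)[of i] f(5)[of i j] fW[of i] fW[of j] that by (auto simp: T_def)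
  \<comment> \<open>Position L + 1 is taken by \<open>v\<close>. As L >= 2, the cycle has length L +
    2 >= 4.\<close>
  define h where "h i = (if i \<le> L then f i else v)" for i
  have adj: "E (h i) (h j) \<longleftrightarrow> cycle_adj (L + 2) i j" if "i < j" "j < L + 2" for i j
  proof (cases "j \<le> L")
    case True
    have "cycle_adj (L + 2) i j \<longleftrightarrow> j = Suc i"
      using True that by (subst cycle_adj_iff) auto
    then show ?thesis using True that Ef[of i j] by (simp add: h_def)
  next
    case False
    then have j: "j = Suc L" using that by simp
    have "E (h i) (h j) \<longleftrightarrow> E v (f i)" using False that j sym by (auto simp: h_def)
    then show ?thesis using vE[of i] that j L by (subst cycle_adj_iff) auto
  qed
  have "E (h i) (h j) \<longleftrightarrow> cycle_adj (L + 2) i j" if "i < L + 2" "j < L + 2" for i j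
  proof (rule linorder_cases[of i j])
    assume "i = j"
    then show ?thesis using irr by (simp add: cycle_adj_irrefl)
  next
    assume "j < i"
    then show ?thesis using adj[of j i] that sym cycle_adj_sym by blast
  qed (use adj that in blast)
  moreover have "inj_on h {..<L + 2}"
  proof (rule inj_onI)
    fix i j assume "i \<in> {..<L + 2}" "j \<in> {..<L + 2}" "h i = h j"
    then show "i = j"
      using fv[of i] fv[of j] inj_onD[OF f(3), of i j] by (auto simp: h_def split: if_splits)
  qed
  moreover have "h ` {..<L + 2} \<subseteq> V"
    using fW C x y by (auto simp: h_def W_def split: if_splits)
  ultimately have "induced_cycle E V (L + 2) h"
    unfolding induced_cycle_def by blast
  then show False using ch L unfolding chordal_on_def by auto
qed

text \<open>
  Take a component \<open>C\<close> of the graph without the closed neighbourhood of \<open>v\<close>. Its boundary \<open>S\<close> is a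
  clique, so by induction \<open>C \<union> S\<close> has a simplicial vertex inside \<open>C\<close>.
\<close>

lemma chordal_simplicial_avoiding:
  assumes "finite V" "chordal_on E V" and sym: "\<And>a b. E a b \<Longrightarrow> E b a" and irr: "\<And>a. \<not> E a a"
    and "v \<in> V" "u \<in> V" "u \<noteq> v" "\<not> E v u"
  shows "\<exists>w\<in>V. w \<noteq> v \<and> \<not> E v w \<and> simplicial E V w"
  using assms(1,2,5-8)
proof (induction "card V" arbitrary: V v u rule: less_induct)
  case less
  define A where "A = {a\<in>V. a \<noteq> v \<and> \<not> E v a}"
  define R where "R = {(a, b). E a b \<and> a \<in> A \<and> b \<in> A}"
  define C where "C = {c. (u, c) \<in> R\<^sup>*}"
  define S where "S = {s\<in>V - C. \<exists>c\<in>C. E s c}"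
  have uA: "u \<in> A" using less by (auto simp: A_def)
  have uC: "u \<in> C" by (simp add: C_def)
  have CA: "C \<subseteq> A"
  proof
    fix c assume "c \<in> C"
    then have "(u, c) \<in> R\<^sup>*" by (simp add: C_def)
    then show "c \<in> A" using uA by (induction) (auto simp: R_def)
  qed
  have R_C: "R `` C \<subseteq> C" by (auto simp: C_def intro: rtrancl.rtrancl_into_rtrancl)
  have SN: "E v s" if s: "s \<in> S" for s
  proof (rule ccontr)
    assume "\<not> E v s"
    obtain c where c: "c \<in> C" "E s c" using s S_def by blast
    have "s \<noteq> v" using c CA by (auto simp: A_def)
    then have "s \<in> A" using that \<open>\<not> E v s\<close> by (auto simp: A_def S_def)
    then have "(c, s) \<in> R" using c CA sym by (auto simp: R_def)
    then have "s \<in> C" using R_C c by blast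
    then show False using that by (simp add: S_def)
  qed
  have symR: "sym R" using sym by (auto simp: R_def sym_def)
  have conn: "(a, b) \<in> {(a, b). E a b \<and> a \<in> C \<and> b \<in> C}\<^sup>*" if "a \<in> C" "b \<in> C" for a b
  proof -
    have "(a, u) \<in> R\<^sup>*" using that(1) symR
      unfolding C_def by (metis mem_Collect_eq sym_rtrancl symD)
    then have "(a, b) \<in> R\<^sup>*" using that(2) by (simp add: C_def)
    then show ?thesis using that(1)
    proof (induction rule: converse_rtrancl_induct)
      case (step y z)
      then have "z \<in> C" using R_C by blast
      then show ?case using step by (intro converse_rtrancl_into_rtrancl[of y z]) (auto simp: R_def)
    qed simp
  qed
  have clique: "E x y" if xy: "x \<in> S" "y \<in> S" "x \<noteq> y" for x y
  proof -
    obtain c1 c2 where "c1 \<in> C" "E x c1" "c2 \<in> C" "E y c2" using xy S_def by blast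
    then show ?thesis
      using chordal_separator_clique[OF less.prems(2) sym irr _ _ _ _ conn, of v x c1 y c2]
        SN that CA less.prems by (auto simp: A_def S_def)
  qed
  define H where "H = C \<union> S"
  have HV: "H \<subseteq> V" using CA by (auto simp: H_def A_def S_def)
  have "v \<notin> H" using CA irr SN by (auto simp: H_def A_def)
  then have "H \<subset> V" using HV less.prems by blast
  then have card: "card H < card V" using less.prems psubset_card_mono by blast
  have finH: "finite H" using HV less.prems finite_subset by blast
  have chH: "chordal_on E H" using chordal_on_subset less.prems HV by blast
  \<comment> \<open>Every neighbour of a vertex of \<open>C\<close> lies in \<open>H\<close>, since
    one outside \<open>C\<close> belongs to \<open>S\<close>. Hence being simplicial in
    \<open>H\<close> is enough.\<close>
  have final: ?case if w: "w \<in> C" "simplicial E H w" for w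
  proof -
    have "a \<in> H" if "a \<in> V" "E w a" for a
      using that w sym by (auto simp: H_def S_def)
    then have "simplicial E V w" using w unfolding simplicial_def by blast
    then show ?thesis using w CA by (auto simp: A_def)
  qed
  \<comment> \<open>The induction hypothesis for \<open>H\<close> needs a vertex with a
    non-neighbour, to play the role of \<open>v\<close>. If \<open>S\<close> has one, the resulting
    \<open>w\<close> is not adjacent to it and so avoids the clique \<open>S\<close>. Failing that,
    vertices of \<open>S\<close> are adjacent to the rest of \<open>H\<close>, so a \<open>w\<close>
    not adjacent to some vertex of \<open>C\<close> avoids \<open>S\<close> as well. If neither
    exists, \<open>H\<close> is complete and \<open>u\<close> itself is simplicial.\<close>
  show ?case
  proof (cases "\<exists>s\<in>S. \<exists>t\<in>H. t \<noteq> s \<and> \<not> E s t")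
    case True
    then obtain s t where "s \<in> S" "t \<in> H" "t \<noteq> s" "\<not> E s t" by blast
    then have "s \<in> H" by (simp add: H_def)
    from less.hyps[OF card finH chH this \<open>t \<in> H\<close> \<open>t \<noteq> s\<close> \<open>\<not> E s t\<close>]
    obtain w where "w \<in> H" "w \<noteq> s" "\<not> E s w" "simplicial E H w" by blast
    moreover have "w \<notin> S" using clique \<open>s \<in> S\<close> \<open>w \<noteq> s\<close> \<open>\<not> E s w\<close> by blast
    ultimately have "w \<in> C" by (simp add: H_def)
    then show ?thesis using \<open>simplicial E H w\<close> by (rule final)
  next
    case False
    show ?thesis
    proof (cases "\<exists>c\<in>C. \<exists>t\<in>H. t \<noteq> c \<and> \<not> E c t")
      case True
      then obtain c t where ct: "c \<in> C" "t \<in> H" "t \<noteq> c" "\<not> E c t" by blast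
      have "c \<in> H" using ct by (simp add: H_def)
      from less.hyps[OF card finH chH this ct(2-4)]
      obtain w where w: "w \<in> H" "w \<noteq> c" "\<not> E c w" "simplicial E H w" by blast
      have "w \<notin> S"
        using False \<open>c \<in> H\<close> w(2,3) sym[of w c] by metis
      then have "w \<in> C" using w(1) by (simp add: H_def)
      then show ?thesis using w(4) by (rule final)
    next
      case noC: False
      have "E a b" if "a \<in> H" "b \<in> H" "a \<noteq> b" for a b
        using False noC that by (metis H_def UnE)
      then have "simplicial E H u"
        unfolding simplicial_def by simp
      with uC show ?thesis by (rule final)
    qed
  qed
qed

lemma chordal_simplicial:
  assumes "finite V" "chordal_on E V" "\<And>a b. E a b \<Longrightarrow> E b a" "\<And>a. \<not> E a a" "V \<noteq> {}"
  shows "\<exists>w\<in>V. simplicial E V w"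
proof (cases "\<exists>v\<in>V. \<exists>u\<in>V. u \<noteq> v \<and> \<not> E v u")
  case True
  then obtain v u where "v \<in> V" "u \<in> V" "u \<noteq> v" "\<not> E v u" by blast
  from chordal_simplicial_avoiding[OF assms(1-4) this] show ?thesis by blast
next
  case False
  then have "simplicial E V w" for w
    unfolding simplicial_def by metis
  then show ?thesis using assms(5) by (meson ex_in_conv)
qed

fun perfect_elimination :: "('v \<Rightarrow> 'v \<Rightarrow> bool) \<Rightarrow> 'v list \<Rightarrow> bool" where
  "perfect_elimination E [] \<longleftrightarrow> True"
| "perfect_elimination E (v # vs) \<longleftrightarrow> v \<notin> set vs \<and> simplicial E (set vs) v \<and> perfect_elimination E vs"

lemma chordal_perfect_elimination:
  assumes "finite V" "chordal_on E V" "\<And>a b. E a b \<Longrightarrow> E b a" "\<And>a. \<not> E a a"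
  shows "\<exists>vs. set vs = V \<and> perfect_elimination E vs"
  using assms(1,2)
proof (induction "card V" arbitrary: V rule: less_induct)
  case less
  show ?case
  proof (cases "V = {}")
    case True
    then have "set [] = V \<and> perfect_elimination E []" by simp
    then show ?thesis by blast
  next
    case False
    then obtain w where w: "w \<in> V" "simplicial E V w"
      using chordal_simplicial[OF less.prems assms(3,4)] by blast
    have "card (V - {w}) < card V" using w less.prems(1) by (meson card_Diff1_less)
    then obtain vs where vs: "set vs = V - {w}" "perfect_elimination E vs"
      using less.hyps[of "V - {w}"] less.prems(1) chordal_on_subset[OF less.prems(2), of "V - {w}"]
      by (metis Diff_subset finite_Diff)
    have "set (w # vs) = V" "perfect_elimination E (w # vs)"
      using w vs by (auto simp: simplicial_def)
    then show ?thesis by blast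
  qed
qed

section \<open>Sums over independent sets\<close>

definition indep :: "('v \<Rightarrow> 'v \<Rightarrow> bool) \<Rightarrow> 'v set \<Rightarrow> 'v set set" where
  "indep E U = {S. S \<subseteq> U \<and> (\<forall>x\<in>S. \<forall>y\<in>S. \<not> E x y)}"

text \<open>These are the independent sets whose monomial divides x^f, the only ones that contribute
  to the coefficient of x^f in a product with the independence polynomial. On them the truncated
  subtraction in \<open>dec\<close> is exact.\<close>

definition indep_supp :: "('v \<Rightarrow> 'v \<Rightarrow> bool) \<Rightarrow> 'v set \<Rightarrow> ('v \<Rightarrow> nat) \<Rightarrow> 'v set set" where
  "indep_supp E U f = {S \<in> indep E U. \<forall>i\<in>S. 0 < f i}"

definition dec :: "('v \<Rightarrow> nat) \<Rightarrow> 'v set \<Rightarrow> 'v \<Rightarrow> nat" where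
  "dec f S i = (if i \<in> S then f i - 1 else f i)"

lemma finite_indep [simp]: "finite U \<Longrightarrow> finite (indep E U)"
  by (rule finite_subset[of _ "Pow U"]) (auto simp: indep_def)

lemma finite_indep_supp [simp]: "finite U \<Longrightarrow> finite (indep_supp E U f)"
  by (simp add: indep_supp_def)

lemma dec_empty [simp]: "dec f {} = f"
  by (simp add: dec_def fun_eq_iff)

text \<open>Deletion identity I(W + v) = I(W) + x_v I(W - N(v)) at the level of summands: the
  independent sets are split by whether they contain \<open>v\<close>.\<close>

lemma sum_indep_supp_insert:
  assumes "finite W" "v \<notin> W" and sym: "\<And>a b. E a b \<Longrightarrow> E b a" and irr: "\<And>a. \<not> E a a"
  shows "(\<Sum>S\<in>indep_supp E (insert v W) f. g S) =
    (\<Sum>S\<in>indep_supp E W f. g S) +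
    (if 0 < f v then \<Sum>S\<in>indep_supp E {w\<in>W. \<not> E v w} f. g (insert v S) else (0::'a::comm_monoid_add))"
proof -
  let ?B = "if 0 < f v then insert v ` indep_supp E {w\<in>W. \<not> E v w} f else {}"
  have eq: "indep_supp E (insert v W) f = indep_supp E W f \<union> ?B"
  proof (intro set_eqI iffI)
    fix S assume S: "S \<in> indep_supp E (insert v W) f"
    show "S \<in> indep_supp E W f \<union> ?B"
    proof (cases "v \<in> S")
      case True
      then have "S - {v} \<in> indep_supp E {w\<in>W. \<not> E v w} f" "0 < f v" "S = insert v (S - {v})"
        using S by (auto simp: indep_supp_def indep_def)
      then have "S \<in> insert v ` indep_supp E {w\<in>W. \<not> E v w} f" by (intro image_eqI[where x = "S - {v}"])
      then show ?thesis using \<open>0 < f v\<close> by simp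
    next
      case False
      then show ?thesis using S by (auto simp: indep_supp_def indep_def)
    qed
  next
    fix S assume "S \<in> indep_supp E W f \<union> ?B"
    then consider "S \<in> indep_supp E W f"
      | T where "0 < f v" "T \<in> indep_supp E {w\<in>W. \<not> E v w} f" "S = insert v T"
      by (auto split: if_splits)
    then show "S \<in> indep_supp E (insert v W) f"
    proof cases
      case 1
      then show ?thesis by (auto simp: indep_supp_def indep_def)
    next
      case (2 T)
      have "\<not> E v w" "\<not> E w v" if "w \<in> T" for w
        using 2(2) that sym[of w v] by (auto simp: indep_supp_def indep_def)
      then show ?thesis using 2 irr by (auto simp: indep_supp_def indep_def)
    qed
  qed
  have "inj_on (insert v) (indep_supp E {w\<in>W. \<not> E v w} f)"
    by (rule inj_on_subset[of _ "Pow W"]) (use assms(2) in \<open>auto simp: inj_on_def indep_supp_def indep_def\<close>)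
  moreover have "indep_supp E W f \<inter> ?B = {}"
    using assms(2) by (auto simp: indep_supp_def indep_def)
  ultimately show ?thesis
    unfolding eq using assms(1) by (subst sum.union_disjoint) (auto simp: sum.reindex)
qed

section \<open>The coefficients for a perfect elimination ordering\<close>

text \<open>The parameter \<open>a\<close> is the exponent of the independence polynomial. It is
  kept general because multiplying by the independence polynomial raises it by one, until
  \<open>a = 0\<close> gives the series 1.\<close>

primrec elim_coeff :: "('v \<Rightarrow> 'v \<Rightarrow> bool) \<Rightarrow> rat \<Rightarrow> 'v list \<Rightarrow> ('v \<Rightarrow> nat) \<Rightarrow> rat" where
  "elim_coeff E a [] f = 1"
| "elim_coeff E a (v # vs) f =
     ((a - (\<Sum>u | u \<in> set vs \<and> E v u. of_nat (f u))) gchoose f v) * elim_coeff E a vs f"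

lemma elim_coeff_cong: "(\<And>i. i \<in> set vs \<Longrightarrow> f i = g i) \<Longrightarrow> elim_coeff E a vs f = elim_coeff E a vs g"
  by (induction vs) (auto intro!: arg_cong2[where f = "(gchoose)"] sum.cong)

lemma gbinomial_pascal: "0 < k \<Longrightarrow> (a + 1) gchoose k = (a gchoose k) + (a gchoose (k - 1))"
  for a :: "'a::field_char_0"
  using gbinomial_Suc_Suc[of a "k - 1"] by simp

text \<open>
  By simpliciality an independent set meets the neighbourhood of the first vertex in at most one
  vertex. In that case the upper argument of the binomial coefficient grows by one; otherwise the
  terms with and without the first vertex combine by Pascal's rule.
\<close>

lemma elim_coeff_indep_sum:
  assumes "perfect_elimination E vs" and sym: "\<And>a b. E a b \<Longrightarrow> E b a" and irr: "\<And>a. \<not> E a a"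
  shows "(\<Sum>S\<in>indep_supp E (set vs) f. elim_coeff E a vs (dec f S)) = elim_coeff E (a + 1) vs f"
  using assms(1)
proof (induction vs)
  case Nil
  have "indep_supp E {} f = {{}}" by (auto simp: indep_supp_def indep_def)
  then show ?case by simp
next
  case (Cons v vs)
  define W where "W = set vs"
  define s where "s g = (\<Sum>u | u \<in> W \<and> E v u. of_nat (g u) :: rat)" for g
  have v: "v \<notin> W" "simplicial E W v" "perfect_elimination E vs"
    using Cons.prems by (auto simp: W_def)
  have fin: "finite W" by (simp add: W_def)
  let ?I = "indep_supp E W f"
  have sI: "S \<subseteq> W" "\<And>i. i \<in> S \<Longrightarrow> 0 < f i" "\<And>x y. x \<in> S \<Longrightarrow> y \<in> S \<Longrightarrow> \<not> E x y" if "S \<in> ?I" for S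
    using that by (auto simp: indep_supp_def indep_def)
  have t1: "elim_coeff E a (v # vs) (dec f S) = ((a - s (dec f S)) gchoose f v) * elim_coeff E a vs (dec f S)"
    if "S \<in> ?I" for S
    using sI(1)[OF that] v by (auto simp: W_def[symmetric] s_def dec_def)
  have t2: "elim_coeff E a (v # vs) (dec f (insert v S)) = ((a - s f) gchoose (f v - 1)) * elim_coeff E a vs (dec f S)"
    if "S \<in> ?I" "\<forall>w\<in>S. \<not> E v w" for S
  proof -
    have "elim_coeff E a vs (dec f (insert v S)) = elim_coeff E a vs (dec f S)"
      using v by (intro elim_coeff_cong) (auto simp: dec_def W_def)
    moreover have "s (dec f (insert v S)) = s f"
      unfolding s_def using v that by (intro sum.cong) (auto simp: dec_def)
    ultimately show ?thesis by (simp add: W_def[symmetric] s_def[symmetric] dec_def[of _ _ v])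
  qed
  have key: "((a - s (dec f S)) gchoose f v) +
      (if 0 < f v \<and> (\<forall>w\<in>S. \<not> E v w) then (a - s f) gchoose (f v - 1) else 0) =
      ((a + 1 - s f) gchoose f v)" if S: "S \<in> ?I" for S
  proof (cases "\<forall>w\<in>S. \<not> E v w")
    case True
    have "s (dec f S) = s f"
      unfolding s_def using True by (intro sum.cong) (auto simp: dec_def)
    then show ?thesis using True gbinomial_pascal[of "f v" "a - s f"]
      by (auto simp: algebra_simps)
  next
    case False
    then obtain u where u: "u \<in> S" "E v u" by blast
    have uniq: "w = u" if "w \<in> S" "E v w" for w
      using v(2) u that sI[OF S] unfolding simplicial_def by blast
    let ?K = "{w. w \<in> W \<and> E v w}"
    have uK: "u \<in> ?K" "finite ?K" using u sI(1)[OF S] fin by auto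
    have "s f = of_nat (f u) + (\<Sum>w\<in>?K - {u}. of_nat (f w))"
      unfolding s_def using uK by (subst sum.remove[of _ u]) auto
    moreover have "s (dec f S) = of_nat (f u - 1) + (\<Sum>w\<in>?K - {u}. of_nat (dec f S w))"
      unfolding s_def using uK u by (subst sum.remove[of _ u]) (auto simp: dec_def)
    moreover have "(\<Sum>w\<in>?K - {u}. of_nat (dec f S w)) = (\<Sum>w\<in>?K - {u}. of_nat (f w) :: rat)"
      using uniq by (intro sum.cong) (auto simp: dec_def)
    ultimately have "s (dec f S) = s f - 1"
      using sI(2)[OF S u(1)] by (simp add: of_nat_diff)
    then have "a - s (dec f S) = a + 1 - s f" by simp
    moreover have "\<not> (0 < f v \<and> (\<forall>w\<in>S. \<not> E v w))" using False by blast
    ultimately show ?thesis by (simp only: if_False add_0_right)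
  qed
  \<comment> \<open>This brings the sets with and without \<open>v\<close> under one index set, so
    that \<open>key\<close> applies termwise.\<close>
  have filt: "indep_supp E {w\<in>W. \<not> E v w} f = {S\<in>?I. \<forall>w\<in>S. \<not> E v w}"
    by (auto simp: indep_supp_def indep_def)
  have "(\<Sum>S\<in>indep_supp E (set (v # vs)) f. elim_coeff E a (v # vs) (dec f S)) =
     (\<Sum>S\<in>?I. elim_coeff E a (v # vs) (dec f S)) +
     (if 0 < f v then \<Sum>S\<in>{S\<in>?I. \<forall>w\<in>S. \<not> E v w}. elim_coeff E a (v # vs) (dec f (insert v S)) else 0)"
    unfolding filt[symmetric] list.set W_def[symmetric]
    by (rule sum_indep_supp_insert[where E = E, OF fin v(1) sym irr])
  also have "(\<Sum>S\<in>?I. elim_coeff E a (v # vs) (dec f S)) =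
      (\<Sum>S\<in>?I. ((a - s (dec f S)) gchoose f v) * elim_coeff E a vs (dec f S))"
    using t1 by (intro sum.cong) auto
  also have "(if 0 < f v then \<Sum>S\<in>{S\<in>?I. \<forall>w\<in>S. \<not> E v w}. elim_coeff E a (v # vs) (dec f (insert v S)) else 0)
     = (\<Sum>S\<in>?I. (if 0 < f v \<and> (\<forall>w\<in>S. \<not> E v w) then (a - s f) gchoose (f v - 1) else 0) * elim_coeff E a vs (dec f S))"
  proof (cases "0 < f v")
    case True
    have "(\<Sum>S\<in>{S\<in>?I. \<forall>w\<in>S. \<not> E v w}. elim_coeff E a (v # vs) (dec f (insert v S)))
      = (\<Sum>S\<in>{S\<in>?I. \<forall>w\<in>S. \<not> E v w}. ((a - s f) gchoose (f v - 1)) * elim_coeff E a vs (dec f S))"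
      using t2 by (intro sum.cong) auto
    also have "\<dots> = (\<Sum>S\<in>?I. if \<forall>w\<in>S. \<not> E v w then ((a - s f) gchoose (f v - 1)) * elim_coeff E a vs (dec f S) else 0)"
      using fin by (intro sum.inter_filter) auto
    finally show ?thesis using True by (auto intro!: sum.cong)
  qed auto
  finally have "(\<Sum>S\<in>indep_supp E (set (v # vs)) f. elim_coeff E a (v # vs) (dec f S)) =
     (\<Sum>S\<in>?I. ((a + 1 - s f) gchoose f v) * elim_coeff E a vs (dec f S))"
    unfolding sum.distrib[symmetric] distrib_right[symmetric] using key by (simp cong: sum.cong)
  also have "\<dots> = ((a + 1 - s f) gchoose f v) * elim_coeff E (a + 1) vs f"
    using Cons.IH[OF v(3)] by (simp add: sum_distrib_left[symmetric] W_def)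
  finally show ?case by (simp add: s_def W_def)
qed

text \<open>If all later exponents vanish, the upper argument of the first binomial is 0, so the
  factor is 1 or 0 according to whether \<open>f v\<close> is 0. Otherwise a factor further down the
  list already vanishes.\<close>

lemma elim_coeff_0: "elim_coeff E 0 vs f = (if \<forall>i\<in>set vs. f i = 0 then 1 else 0)"
proof (induction vs)
  case (Cons v vs)
  then show ?case by (auto simp: gbinomial_0_left)
qed simp

text \<open>All factors a, a - 1, a - 2, ... of the falling factorial are negative.\<close>

lemma gbinomial_neg_nonzero: "a < 0 \<Longrightarrow> a gchoose k \<noteq> (0 :: rat)"
  using gbinomial_mult_fact[of k a] by (auto simp: prod_zero_iff)

lemma elim_coeff_nonzero: "a < 0 \<Longrightarrow> elim_coeff E a vs f \<noteq> 0"
proof (induction vs)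
  case (Cons v vs)
  have "(\<Sum>u | u \<in> set vs \<and> E v u. of_nat (f u)) \<ge> (0::rat)" by (intro sum_nonneg) auto
  then show ?case using Cons by (auto intro!: gbinomial_neg_nonzero)
qed simp

section \<open>Polynomial functions\<close>

definition mono_eval :: "('v \<Rightarrow>\<^sub>0 nat) \<Rightarrow> ('v \<Rightarrow> 'a::comm_ring_1) \<Rightarrow> 'a" where
  "mono_eval a x = (\<Prod>j\<in>Poly_Mapping.keys a. x j ^ Poly_Mapping.lookup a j)"

lemma mono_eval_superset:
  assumes "finite K" "Poly_Mapping.keys a \<subseteq> K"
  shows "mono_eval a x = (\<Prod>j\<in>K. x j ^ Poly_Mapping.lookup a j)"
  unfolding mono_eval_def using assms
  by (intro prod.mono_neutral_left) (auto simp: in_keys_iff)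

lemma mono_eval_add: "mono_eval (a + b) x = mono_eval a x * mono_eval b x"
proof -
  let ?K = "Poly_Mapping.keys a \<union> Poly_Mapping.keys b"
  have "mono_eval c x = (\<Prod>j\<in>?K. x j ^ Poly_Mapping.lookup c j)" if "Poly_Mapping.keys c \<subseteq> ?K" for c
    using that by (intro mono_eval_superset) auto
  then show ?thesis
    by (simp add: keys_add lookup_add power_add prod.distrib)
qed

lemma mpoly_eval_superset:
  assumes "finite K" "Poly_Mapping.keys P \<subseteq> K"
  shows "mpoly_eval P x = (\<Sum>a\<in>K. Poly_Mapping.lookup P a * mono_eval a x)"
  unfolding mpoly_eval_def mono_eval_def using assms
  by (intro sum.mono_neutral_left) (auto simp: in_keys_iff)

text \<open>Closure properties are proved for the functions, so that the finitely supported maps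
  demanded by the Horn condition never have to be manipulated explicitly later on.\<close>

definition poly_fun :: "'v set \<Rightarrow> (('v \<Rightarrow> 'a::comm_ring_1) \<Rightarrow> 'a) \<Rightarrow> bool" where
  "poly_fun J g \<longleftrightarrow> (\<exists>P\<in>polys_in J. \<forall>x. mpoly_eval P x = g x)"

lemma poly_fun_monom:
  assumes "Poly_Mapping.keys a \<subseteq> J"
  shows "poly_fun J (\<lambda>x. c * mono_eval a x)"
  unfolding poly_fun_def
proof (intro bexI allI)
  show "Poly_Mapping.single a c \<in> polys_in J"
    using assms by (auto simp: polys_in_def split: if_splits)
  show "mpoly_eval (Poly_Mapping.single a c) x = c * mono_eval a x" for x
    by (subst mpoly_eval_superset[of "{a}"]) auto
qed

lemma poly_fun_add:
  assumes "poly_fun J g" "poly_fun J h"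
  shows "poly_fun J (\<lambda>x. g x + h x)"
proof -
  obtain P Q where PQ: "P \<in> polys_in J" "Q \<in> polys_in J" "\<And>x. mpoly_eval P x = g x" "\<And>x. mpoly_eval Q x = h x"
    using assms unfolding poly_fun_def by blast
  have "P + Q \<in> polys_in J"
    using PQ(1,2) Poly_Mapping.keys_add[of P Q] by (auto simp: polys_in_def)
  moreover have "mpoly_eval (P + Q) x = g x + h x" for x
  proof -
    let ?K = "Poly_Mapping.keys P \<union> Poly_Mapping.keys Q"
    have "mpoly_eval R x = (\<Sum>a\<in>?K. Poly_Mapping.lookup R a * mono_eval a x)"
      if "Poly_Mapping.keys R \<subseteq> ?K" for R
      using that by (intro mpoly_eval_superset) auto
    then have "mpoly_eval (P + Q) x = mpoly_eval P x + mpoly_eval Q x"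
      by (simp add: Poly_Mapping.keys_add lookup_add distrib_right sum.distrib)
    then show ?thesis by (simp add: PQ)
  qed
  ultimately show ?thesis unfolding poly_fun_def by blast
qed

lemma poly_fun_const: "poly_fun J (\<lambda>x. c)"
  using poly_fun_monom[of 0 J c] by (simp add: mono_eval_def)

lemma poly_fun_var: "j \<in> J \<Longrightarrow> poly_fun J (\<lambda>x. x j)"
  using poly_fun_monom[of "Poly_Mapping.single j 1" J 1] by (simp add: mono_eval_def)

lemma poly_fun_sum: "(\<And>a. a \<in> A \<Longrightarrow> poly_fun J (g a)) \<Longrightarrow> poly_fun J (\<lambda>x. \<Sum>a\<in>A. g a x)"
  by (induction A rule: infinite_finite_induct) (auto intro: poly_fun_const poly_fun_add)

lemma poly_fun_mult:
  assumes "poly_fun J g" "poly_fun J h"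
  shows "poly_fun J (\<lambda>x. g x * h x)"
proof -
  obtain P Q where PQ: "P \<in> polys_in J" "Q \<in> polys_in J" "\<And>x. mpoly_eval P x = g x" "\<And>x. mpoly_eval Q x = h x"
    using assms unfolding poly_fun_def by blast
  have "g x * h x = (\<Sum>a\<in>Poly_Mapping.keys P. \<Sum>b\<in>Poly_Mapping.keys Q.
      (Poly_Mapping.lookup P a * Poly_Mapping.lookup Q b) * mono_eval (a + b) x)" for x
    unfolding PQ(3,4)[symmetric] mpoly_eval_def mono_eval_def[symmetric] sum_product
    by (simp add: mono_eval_add mult_ac)
  moreover have "Poly_Mapping.keys (a + b) \<subseteq> J"
    if "a \<in> Poly_Mapping.keys P" "b \<in> Poly_Mapping.keys Q" for a b
  proof -
    have "Poly_Mapping.keys a \<subseteq> J" "Poly_Mapping.keys b \<subseteq> J"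
      using PQ(1,2) that by (auto simp: polys_in_def)
    then show ?thesis using Poly_Mapping.keys_add[of a b] by blast
  qed
  then have "poly_fun J (\<lambda>x. \<Sum>a\<in>Poly_Mapping.keys P. \<Sum>b\<in>Poly_Mapping.keys Q.
      (Poly_Mapping.lookup P a * Poly_Mapping.lookup Q b) * mono_eval (a + b) x)"
    by (intro poly_fun_sum poly_fun_monom)
  ultimately show ?thesis by simp
qed

lemma poly_fun_diff: "poly_fun J g \<Longrightarrow> poly_fun J h \<Longrightarrow> poly_fun J (\<lambda>x. g x - h x)"
  using poly_fun_add[of J g "\<lambda>x. - 1 * h x"] poly_fun_mult[OF poly_fun_const[of J "-1"], of h] by simp

lemma gbinomial_absorb_up: "(a gchoose Suc k) * (of_nat k + 1) = (a gchoose k) * (a - of_nat k)"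
  for a :: rat
  using gbinomial_mult_1[of a k] by (simp add: algebra_simps)

text \<open>Raising \<open>f i\<close> changes the lower argument in the factor of \<open>i\<close>,
  and lowers by one the upper argument in the factors of those vertices before \<open>i\<close> that
  are adjacent to it. By absorption the quotients are (b - k)/(k + 1) and (b - k)/b. The functions
  \<open>p\<close> and \<open>q\<close> are chosen before \<open>f\<close>, hence are uniform over
  all exponents with support \<open>J\<close>.\<close>

lemma elim_coeff_ratio:
  assumes "perfect_elimination E vs" "a < 0" "i \<in> J"
  shows "\<exists>p q. poly_fun J p \<and> poly_fun J q \<and> (\<forall>f. (\<forall>j. 0 < f j \<longleftrightarrow> j \<in> J) \<longrightarrow>
    q (\<lambda>j. of_nat (f j)) \<noteq> 0 \<and>
    elim_coeff E a vs (f(i := f i + 1)) * q (\<lambda>j. of_nat (f j)) = elim_coeff E a vs f * p (\<lambda>j. of_nat (f j)))"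
  using assms(1)
proof (induction vs)
  case Nil
  then show ?case by (intro exI[of _ "\<lambda>_. 1"]) (simp add: poly_fun_const)
next
  case (Cons v vs)
  define K where "K = {u. u \<in> set vs \<and> E v u}"
  define s where "s x = (\<Sum>u\<in>K. x u :: rat)" for x
  \<comment> \<open>Only variables from \<open>J\<close> may occur in the polynomials. On exponents
    with support \<open>J\<close> the omitted terms are zero.\<close>
  define t where "t x = (\<Sum>u\<in>K \<inter> J. x u :: rat)" for x
  have finK: "finite K" by (simp add: K_def)
  have st: "s (\<lambda>j. of_nat (f j)) = t (\<lambda>j. of_nat (f j))" if "\<forall>j. 0 < f j \<longleftrightarrow> j \<in> J" for f
    unfolding s_def t_def using that finK by (intro sum.mono_neutral_right) auto
  have step: "elim_coeff E a (v # vs) f = ((a - s (\<lambda>j. of_nat (f j))) gchoose f v) * elim_coeff E a vs f" for f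
    by (simp add: s_def K_def)
  have pt: "poly_fun J t" unfolding t_def by (intro poly_fun_sum poly_fun_var) auto
  have tneg: "a - t (\<lambda>j. of_nat (f j)) < 0" for f
  proof -
    have "t (\<lambda>j. of_nat (f j)) \<ge> 0" unfolding t_def by (intro sum_nonneg) auto
    then show ?thesis using assms(2) by linarith
  qed
  obtain p q where pq: "poly_fun J p" "poly_fun J q" "\<And>f. (\<forall>j. 0 < f j \<longleftrightarrow> j \<in> J) \<Longrightarrow>
    q (\<lambda>j. of_nat (f j)) \<noteq> 0 \<and>
    elim_coeff E a vs (f(i := f i + 1)) * q (\<lambda>j. of_nat (f j)) = elim_coeff E a vs f * p (\<lambda>j. of_nat (f j))"
    using Cons.IH Cons.prems unfolding perfect_elimination.simps by blast
  have vK: "v \<notin> set vs" using Cons.prems by simp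
  have "\<exists>p' q'. poly_fun J p' \<and> poly_fun J q' \<and> (\<forall>f. (\<forall>j. 0 < f j \<longleftrightarrow> j \<in> J) \<longrightarrow>
    q' (\<lambda>j. of_nat (f j)) \<noteq> 0 \<and>
    ((a - s (\<lambda>j. of_nat ((f(i := f i + 1)) j))) gchoose (f(i := f i + 1)) v) * q' (\<lambda>j. of_nat (f j))
      = ((a - s (\<lambda>j. of_nat (f j))) gchoose f v) * p' (\<lambda>j. of_nat (f j)))"
  proof (cases "v = i")
    case True
    have "s (\<lambda>j. of_nat ((f(i := f i + 1)) j)) = s (\<lambda>j. of_nat (f j))" for f
      unfolding s_def using True vK by (intro sum.cong) (auto simp: K_def)
    then show ?thesis
      using True assms(3) st gbinomial_absorb_up
      by (intro exI[of _ "\<lambda>x. a - t x - x i"] exI[of _ "\<lambda>x. x i + 1"] conjI allI impI)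
         (auto intro!: poly_fun_add poly_fun_diff poly_fun_const poly_fun_var pt simp: add_eq_0_iff2
               simp del: gbinomial_0)
  next
    case vi: False
    show ?thesis
    proof (cases "i \<in> K \<and> v \<in> J")
      case True
      have up: "s (\<lambda>j. of_nat ((f(i := f i + 1)) j)) = s (\<lambda>j. of_nat (f j)) + 1" for f :: "'a \<Rightarrow> nat"
      proof -
        have "s x = x i + sum x (K - {i})" for x
          unfolding s_def using True finK by (subst sum.remove[of _ i]) auto
        moreover have "(\<Sum>j\<in>K - {i}. of_nat ((f(i := f i + 1)) j)) = (\<Sum>j\<in>K - {i}. of_nat (f j) :: rat)"
          by (intro sum.cong) auto
        ultimately show ?thesis by simp
      qed
      have absorb: "((\<alpha> - 1) gchoose k) * \<alpha> = (\<alpha> gchoose k) * (\<alpha> - of_nat k)" for \<alpha> :: rat and k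
        using gbinomial_absorb_comp[of \<alpha> k] by (simp add: mult.commute)
      show ?thesis
      proof (intro exI conjI allI impI)
        show "poly_fun J (\<lambda>x. a - t x - x v)" "poly_fun J (\<lambda>x. a - t x)"
          using True by (auto intro!: poly_fun_diff poly_fun_const poly_fun_var pt)
        fix f :: "'a \<Rightarrow> nat" assume f: "\<forall>j. 0 < f j \<longleftrightarrow> j \<in> J"
        show "a - t (\<lambda>j. of_nat (f j)) \<noteq> 0" using tneg[of f] by simp
        show "((a - s (\<lambda>j. of_nat ((f(i := f i + 1)) j))) gchoose (f(i := f i + 1)) v) * (a - t (\<lambda>j. of_nat (f j)))
          = ((a - s (\<lambda>j. of_nat (f j))) gchoose f v) * (a - t (\<lambda>j. of_nat (f j)) - of_nat (f v))"
          by (simp only: up st[OF f] fun_upd_other[OF vi] diff_diff_eq[symmetric] absorb)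
      qed
    next
      case False
      have eq: "((a - s (\<lambda>j. of_nat ((f(i := f i + 1)) j))) gchoose (f(i := f i + 1)) v) =
        ((a - s (\<lambda>j. of_nat (f j))) gchoose f v)" if "\<forall>j. 0 < f j \<longleftrightarrow> j \<in> J" for f
      proof (cases "i \<in> K")
        case True
        \<comment> \<open>Here \<open>v\<close> lies outside \<open>J\<close>. A binomial
          coefficient with lower argument 0 is 1, whatever happens to its upper argument.\<close>
        then have "f v = 0" using that False by auto
        then show ?thesis using vi by simp
      next
        case False
        then have "s (\<lambda>j. of_nat ((f(i := f i + 1)) j)) = s (\<lambda>j. of_nat (f j))"
          unfolding s_def by (intro sum.cong) auto
        then show ?thesis using vi by simp
      qed
      show ?thesis
        by (intro exI[of _ "\<lambda>_. 1"] conjI allI impI poly_fun_const arg_cong2[where f = "(*)"] eq)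
           simp_all
    qed
  qed
  then obtain p' q' where pq': "poly_fun J p'" "poly_fun J q'" "\<And>f. (\<forall>j. 0 < f j \<longleftrightarrow> j \<in> J) \<Longrightarrow>
    q' (\<lambda>j. of_nat (f j)) \<noteq> 0 \<and>
    ((a - s (\<lambda>j. of_nat ((f(i := f i + 1)) j))) gchoose (f(i := f i + 1)) v) * q' (\<lambda>j. of_nat (f j))
      = ((a - s (\<lambda>j. of_nat (f j))) gchoose f v) * p' (\<lambda>j. of_nat (f j))"
    by blast
  show ?case
  proof (intro exI conjI allI impI)
    show "poly_fun J (\<lambda>x. p' x * p x)" "poly_fun J (\<lambda>x. q' x * q x)"
      using pq pq' by (auto intro: poly_fun_mult)
    fix f :: "'a \<Rightarrow> nat" assume f: "\<forall>j. 0 < f j \<longleftrightarrow> j \<in> J"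
    let ?x = "\<lambda>j. of_nat (f j) :: rat"
    show "q' ?x * q ?x \<noteq> 0" using pq(3)[OF f] pq'(3)[OF f] by simp
    show "elim_coeff E a (v # vs) (f(i := f i + 1)) * (q' ?x * q ?x) = elim_coeff E a (v # vs) f * (p' ?x * p ?x)"
      unfolding step using conjunct2[OF pq(3)[OF f]] conjunct2[OF pq'(3)[OF f]] by algebra
  qed
qed

section \<open>Power series of independent sets\<close>

lemma mcoeff_X_times:
  "mcoeff (mfps_X i * F) m =
    (if i \<in> Poly_Mapping.keys m then mcoeff F (m - Poly_Mapping.single i 1) else 0)"
proof (cases "i \<in> Poly_Mapping.keys m")
  case True
  let ?e = "Poly_Mapping.single i (1::nat)"
  have m: "?e + (m - ?e) = m"
    using True by (intro poly_mapping_eqI) (auto simp: lookup_add lookup_minus lookup_single when_def in_keys_iff)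
  have "mcoeff (mfps_X i * F) m = (\<Sum>p | fst p + snd p = m. mcoeff (mfps_X i) (fst p) * mcoeff F (snd p))"
    by (simp add: times_mfps.rep_eq case_prod_unfold)
  also have "\<dots> = (\<Sum>p\<in>{(?e, m - ?e)}. mcoeff (mfps_X i) (fst p) * mcoeff F (snd p))"
    using finite_splits[of m] m
    by (intro sum.mono_neutral_right) (auto simp: mfps_X.rep_eq case_prod_unfold)
  finally show ?thesis using True by (simp add: mfps_X.rep_eq)
next
  case False
  have "mcoeff (mfps_X i * F) m = (\<Sum>p | fst p + snd p = m. mcoeff (mfps_X i) (fst p) * mcoeff F (snd p))"
    by (simp add: times_mfps.rep_eq case_prod_unfold)
  also have "\<dots> = 0"
    using False by (intro sum.neutral) (auto simp: mfps_X.rep_eq in_keys_iff lookup_add)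
  finally show ?thesis using False by simp
qed

definition ind_exp :: "'v set \<Rightarrow> 'v \<Rightarrow>\<^sub>0 nat" where
  "ind_exp S = (\<Sum>i\<in>S. Poly_Mapping.single i 1)"

lemma lookup_minus_ind_exp:
  assumes "finite S"
  shows "Poly_Mapping.lookup (m - ind_exp S) = dec (Poly_Mapping.lookup m) S"
proof -
  have "Poly_Mapping.lookup (ind_exp S) j = (if j \<in> S then 1 else 0)" for j
    using assms unfolding ind_exp_def
    by (induction S) (auto simp: lookup_add lookup_single when_def)
  then show ?thesis by (auto simp: dec_def lookup_minus fun_eq_iff)
qed

lemma mcoeff_prod_X_times:
  assumes "finite S"
  shows "mcoeff ((\<Prod>i\<in>S. mfps_X i) * F) m =
    (if S \<subseteq> Poly_Mapping.keys m then mcoeff F (m - ind_exp S) else 0)"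
  using assms
proof (induction S arbitrary: m)
  case (insert i S)
  have "S \<subseteq> Poly_Mapping.keys (m - Poly_Mapping.single i 1) \<longleftrightarrow> S \<subseteq> Poly_Mapping.keys m"
  proof -
    have "j \<in> Poly_Mapping.keys (m - Poly_Mapping.single i 1) \<longleftrightarrow> j \<in> Poly_Mapping.keys m" if "j \<in> S" for j
      using that insert.hyps by (auto simp: in_keys_iff lookup_minus lookup_single when_def)
    then show ?thesis by blast
  qed
  then show ?case
    using insert by (simp add: mult.assoc mcoeff_X_times ind_exp_def diff_diff_add)
qed (simp add: ind_exp_def)

definition indep_poly :: "('v \<Rightarrow> 'v \<Rightarrow> bool) \<Rightarrow> 'v set \<Rightarrow> ('v, rat) mfps" where
  "indep_poly E V = (\<Sum>S\<in>indep E V. \<Prod>i\<in>S. mfps_X i)"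

lemma mcoeff_sum: "mcoeff (\<Sum>a\<in>A. F a) m = (\<Sum>a\<in>A. mcoeff (F a) m)"
  by (induction A rule: infinite_finite_induct) (simp_all add: zero_mfps.rep_eq plus_mfps.rep_eq)

lemma mcoeff_indep_poly_times:
  assumes "finite V"
  shows "mcoeff (indep_poly E V * F) m =
    (\<Sum>S\<in>indep_supp E V (Poly_Mapping.lookup m). mcoeff F (m - ind_exp S))"
proof -
  have fin: "finite S" if "S \<in> indep E V" for S
    using that assms by (auto simp: indep_def intro: finite_subset)
  have "mcoeff (indep_poly E V * F) m =
     (\<Sum>S\<in>indep E V. if S \<subseteq> Poly_Mapping.keys m then mcoeff F (m - ind_exp S) else 0)"
    unfolding indep_poly_def sum_distrib_right mcoeff_sum
    by (intro sum.cong refl mcoeff_prod_X_times fin)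
  also have "\<dots> = (\<Sum>S\<in>{S\<in>indep E V. S \<subseteq> Poly_Mapping.keys m}. mcoeff F (m - ind_exp S))"
    using assms by (intro sum.inter_filter[symmetric]) simp
  also have "{S\<in>indep E V. S \<subseteq> Poly_Mapping.keys m} = indep_supp E V (Poly_Mapping.lookup m)"
    by (auto simp: indep_supp_def in_keys_iff)
  finally show ?thesis .
qed

lemma indep_supp_finite: "finite V \<Longrightarrow> S \<in> indep_supp E V f \<Longrightarrow> finite S"
  by (auto simp: indep_supp_def indep_def intro: finite_subset)

lemma indep_poly_inverse:
  assumes "finite V"
  shows "indep_poly E V * inverse (indep_poly E V) = 1"
proof (rule mfps_right_inverse)
  have "indep_supp E V (Poly_Mapping.lookup 0) = {{}}"
    by (auto simp: indep_supp_def indep_def)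
  then have "mcoeff (indep_poly E V * 1) 0 = 1"
    using assms by (subst mcoeff_indep_poly_times) (simp_all add: one_mfps.rep_eq ind_exp_def)
  then show "mcoeff (indep_poly E V) 0 \<noteq> 0" by simp
qed

definition elim_series :: "('v \<Rightarrow> 'v \<Rightarrow> bool) \<Rightarrow> 'v list \<Rightarrow> nat \<Rightarrow> ('v, rat) mfps" where
  "elim_series E vs q = Abs_mfps (\<lambda>m. if Poly_Mapping.keys m \<subseteq> set vs
     then elim_coeff E (- of_nat q) vs (Poly_Mapping.lookup m) else 0)"

lemma mcoeff_elim_series:
  "mcoeff (elim_series E vs q) m = (if Poly_Mapping.keys m \<subseteq> set vs
     then elim_coeff E (- of_nat q) vs (Poly_Mapping.lookup m) else 0)"
  by (simp add: elim_series_def Abs_mfps_inverse)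

text \<open>No power is expanded: the explicit series F_q satisfy F_0 = 1 and I F_(q+1) = F_q, and
  \<open>I\<close> is invertible.\<close>

lemma indep_poly_inverse_power:
  assumes "perfect_elimination E vs" and sym: "\<And>a b. E a b \<Longrightarrow> E b a" and irr: "\<And>a. \<not> E a a"
  shows "inverse (indep_poly E (set vs)) ^ q = elim_series E vs q"
proof (induction q)
  case 0
  show ?case
  proof (rule mfps_eqI)
    fix m :: "'a \<Rightarrow>\<^sub>0 nat"
    have "Poly_Mapping.keys m \<subseteq> set vs \<and> (\<forall>i\<in>set vs. Poly_Mapping.lookup m i = 0) \<longleftrightarrow> m = 0"
      by (auto simp: in_keys_iff subset_iff intro!: poly_mapping_eqI)
    then show "mcoeff (inverse (indep_poly E (set vs)) ^ 0) m = mcoeff (elim_series E vs 0) m"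
      by (auto simp: mcoeff_elim_series one_mfps.rep_eq elim_coeff_0)
  qed
next
  case (Suc q)
  have "indep_poly E (set vs) * elim_series E vs (Suc q) = elim_series E vs q"
  proof (rule mfps_eqI)
    fix m :: "'a \<Rightarrow>\<^sub>0 nat"
    let ?f = "Poly_Mapping.lookup m"
    have keys: "Poly_Mapping.keys (m - ind_exp S) \<subseteq> set vs \<longleftrightarrow> Poly_Mapping.keys m \<subseteq> set vs"
      if "S \<in> indep_supp E (set vs) ?f" for S
    proof -
      have "finite S" "S \<subseteq> set vs"
        using that indep_supp_finite[OF finite_set] by (auto simp: indep_supp_def indep_def)
      then show ?thesis
        by (auto simp: subset_iff in_keys_iff lookup_minus_ind_exp dec_def)
    qed
    have "mcoeff (indep_poly E (set vs) * elim_series E vs (Suc q)) m =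
      (\<Sum>S\<in>indep_supp E (set vs) ?f. if Poly_Mapping.keys m \<subseteq> set vs
         then elim_coeff E (- of_nat (Suc q)) vs (dec ?f S) else 0)"
      unfolding mcoeff_indep_poly_times[OF finite_set]
      by (intro sum.cong refl) (simp add: mcoeff_elim_series keys lookup_minus_ind_exp indep_supp_finite[OF finite_set])
    also have "\<dots> = (if Poly_Mapping.keys m \<subseteq> set vs then elim_coeff E (- of_nat (Suc q) + 1) vs ?f else 0)"
      using elim_coeff_indep_sum[OF assms(1) sym irr] by simp
    also have "\<dots> = mcoeff (elim_series E vs q) m" by (simp add: mcoeff_elim_series)
    finally show "mcoeff (indep_poly E (set vs) * elim_series E vs (Suc q)) m = mcoeff (elim_series E vs q) m" .
  qed
  then have "inverse (indep_poly E (set vs)) * elim_series E vs q =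
      (indep_poly E (set vs) * inverse (indep_poly E (set vs))) * elim_series E vs (Suc q)"
    by (metis mult.assoc mult.commute)
  then show ?case using Suc by (simp add: indep_poly_inverse)
qed

lemma horn_elim_series:
  assumes "perfect_elimination E vs" "q \<ge> 1"
  shows "horn_hypergeometric (set vs) (elim_series E vs q)"
  unfolding horn_hypergeometric_def
proof (intro conjI allI impI ballI)
  show "elim_series E vs q \<in> mfps_in (set vs)" by (simp add: mfps_in_def mcoeff_elim_series)
  have neg: "- of_nat q < (0::rat)" using assms(2) by simp
  show "mcoeff (elim_series E vs q) m \<noteq> 0" if "Poly_Mapping.keys m \<subseteq> set vs" for m
    using that elim_coeff_nonzero[OF neg] by (simp add: mcoeff_elim_series)
  fix J i assume J: "J \<subseteq> set vs" "i \<in> J"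
  obtain p r where pr: "poly_fun J p" "poly_fun J r" "\<And>f. (\<forall>j. 0 < f j \<longleftrightarrow> j \<in> J) \<Longrightarrow>
    r (\<lambda>j. of_nat (f j)) \<noteq> 0 \<and>
    elim_coeff E (- of_nat q) vs (f(i := f i + 1)) * r (\<lambda>j. of_nat (f j)) = elim_coeff E (- of_nat q) vs f * p (\<lambda>j. of_nat (f j))"
    using elim_coeff_ratio[OF assms(1) neg J(2)] by blast
  obtain P R where PR: "P \<in> polys_in J" "R \<in> polys_in J" "\<And>x. mpoly_eval P x = p x" "\<And>x. mpoly_eval R x = r x"
    using pr(1,2) unfolding poly_fun_def by blast
  have "mpoly_eval R (\<lambda>j. of_nat (Poly_Mapping.lookup m j)) \<noteq> 0 \<and>
        mcoeff (elim_series E vs q) (m + Poly_Mapping.single i 1) / mcoeff (elim_series E vs q) m =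
          mpoly_eval P (\<lambda>j. of_nat (Poly_Mapping.lookup m j)) /
          mpoly_eval R (\<lambda>j. of_nat (Poly_Mapping.lookup m j))" if m: "Poly_Mapping.keys m = J" for m
  proof -
    let ?f = "Poly_Mapping.lookup m"
    have f: "\<forall>j. 0 < ?f j \<longleftrightarrow> j \<in> J" using m by (auto simp: in_keys_iff)
    have up: "Poly_Mapping.lookup (m + Poly_Mapping.single i 1) = ?f(i := ?f i + 1)"
      by (auto simp: fun_eq_iff lookup_add lookup_single when_def)
    have "Poly_Mapping.keys (m + Poly_Mapping.single i 1) \<subseteq> set vs"
      using J m Poly_Mapping.keys_add[of m "Poly_Mapping.single i 1"] by auto
    then show ?thesis
      using pr(3)[OF f] J m elim_coeff_nonzero[OF neg, of E vs ?f]
      by (simp add: PR mcoeff_elim_series up[simplified] frac_eq_eq mult.commute)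
  qed
  then show "\<exists>P\<in>polys_in J. \<exists>Q\<in>polys_in J. \<forall>m. Poly_Mapping.keys m = J \<longrightarrow>
        mpoly_eval Q (\<lambda>j. of_nat (Poly_Mapping.lookup m j)) \<noteq> 0 \<and>
        mcoeff (elim_series E vs q) (m + Poly_Mapping.single i 1) / mcoeff (elim_series E vs q) m =
          mpoly_eval P (\<lambda>j. of_nat (Poly_Mapping.lookup m j)) /
          mpoly_eval Q (\<lambda>j. of_nat (Poly_Mapping.lookup m j))"
    by (intro bexI[OF _ PR(1)] bexI[OF _ PR(2)] allI impI)
qed

section \<open>From an induced cycle to an irrational growth rate\<close>

section \<open>Signed sums over independent sets\<close>

text \<open>If \<open>h\<close> lists the coefficients of H, this is the coefficient of x^a in
  I_U(-x) H(x). For empty \<open>U\<close> it is \<open>h a\<close>, which is how bounds on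
  \<open>h\<close> itself are read off.\<close>

definition ind_sum :: "('v \<Rightarrow> 'v \<Rightarrow> bool) \<Rightarrow> 'v set \<Rightarrow> (('v \<Rightarrow> nat) \<Rightarrow> real) \<Rightarrow> ('v \<Rightarrow> nat) \<Rightarrow> real" where
  "ind_sum E U h a = (\<Sum>S\<in>indep_supp E U a. (-1) ^ card S * h (dec a S))"

definition supp :: "('v \<Rightarrow> nat) \<Rightarrow> 'v set" where
  "supp a = {i. a i \<noteq> 0}"

lemma supp_dec: "supp (dec a S) \<subseteq> supp a"
  by (auto simp: supp_def dec_def)

lemma ind_sum_empty [simp]: "ind_sum E {} h a = h a"
proof -
  have "indep_supp E {} a = {{}}" by (auto simp: indep_supp_def indep_def)
  then show ?thesis by (simp add: ind_sum_def)
qed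

lemma ind_sum_diff: "ind_sum E U (\<lambda>b. h b - g b) a = ind_sum E U h a - ind_sum E U g a"
  by (simp add: ind_sum_def sum_subtractf right_diff_distrib)

lemma ind_sum_scale: "ind_sum E U (\<lambda>b. c * h b) a = c * ind_sum E U h a"
  by (simp add: ind_sum_def sum_distrib_left mult_ac)

lemma ind_sum_cong:
  assumes "\<And>b. supp b \<subseteq> supp a \<Longrightarrow> h b = g b"
  shows "ind_sum E U h a = ind_sum E U g a"
  unfolding ind_sum_def by (intro sum.cong refl) (simp add: assms[OF supp_dec])

lemma ind_sum_insert:
  assumes "finite W" "v \<notin> W" "\<And>a b. E a b \<Longrightarrow> E b a" "\<And>a. \<not> E a a"
  shows "ind_sum E (insert v W) h a = ind_sum E W h a -
    (if 0 < a v then ind_sum E {w\<in>W. \<not> E v w} h (dec a {v}) else 0)"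
proof -
  let ?W = "{w\<in>W. \<not> E v w}"
  have eq: "indep_supp E ?W (dec a {v}) = indep_supp E ?W a"
    using assms(2) by (auto simp: indep_supp_def indep_def dec_def)
  have "(-1) ^ card (insert v S) * h (dec a (insert v S)) = - ((-1) ^ card S * h (dec (dec a {v}) S))"
    if "S \<in> indep_supp E ?W a" for S
  proof -
    have "v \<notin> S" "finite S"
      using that assms(1,2) indep_supp_finite[of ?W S E a] by (auto simp: indep_supp_def indep_def)
    moreover have "dec a (insert v S) = dec (dec a {v}) S"
      using \<open>v \<notin> S\<close> by (auto simp: dec_def fun_eq_iff)
    ultimately show ?thesis by simp
  qed
  then have "(\<Sum>S\<in>indep_supp E ?W a. (-1) ^ card (insert v S) * h (dec a (insert v S))) =
     - ind_sum E ?W h (dec a {v})"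
    unfolding ind_sum_def eq by (simp add: sum_negf)
  then show ?thesis
    using sum_indep_supp_insert[where E = E and f = a and g = "\<lambda>S. (-1) ^ card S * h (dec a S)", OF assms]
    by (simp add: ind_sum_def)
qed

text \<open>
  In terms of generating functions: if $I_V \cdot H$ has nonnegative coefficients, then so has
  $I_U \cdot H$ for every $U \subseteq V$, where $I_U$ is the independence polynomial of the
  subgraph induced on $U$ with all variables negated.
\<close>

lemma ind_sum_nonneg:
  assumes fin: "finite V" and E: "\<And>a b. E a b \<Longrightarrow> E b a" "\<And>a. \<not> E a a"
    and h: "\<And>a. supp a \<subseteq> V \<Longrightarrow> 0 \<le> ind_sum E V h a"
    and "U \<subseteq> V" "supp a \<subseteq> V"
  shows "0 \<le> ind_sum E U h a"
  using assms(5,6)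
\<comment> \<open>The deletion identity is read as I_U = I_(U+v) + x_v I_(U-N(v)). The first term is
  nonnegative by the inner induction on the number of missing vertices, the second by the outer
  induction on the degree.\<close>
proof (induction "sum a V" arbitrary: a U rule: less_induct)
  case less
  note outer = less.hyps and supp = less.prems(2)
  show ?case
    using less.prems(1)
  proof (induction "card (V - U)" arbitrary: U rule: less_induct)
    case less
    show ?case
    proof (cases "U = V")
      case False
      then obtain v where v: "v \<in> V" "v \<notin> U" using less.prems by blast
      have finU: "finite U" using less.prems fin finite_subset by blast
      have "V - insert v U \<subset> V - U" using v by blast
      then have "card (V - insert v U) < card (V - U)" using fin psubset_card_mono by blast
      then have 1: "0 \<le> ind_sum E (insert v U) h a"
        by (rule less.hyps) (use less.prems v in simp)
      have 2: "0 \<le> ind_sum E {w\<in>U. \<not> E v w} h (dec a {v})" if "0 < a v"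
      proof (rule outer)
        show "sum (dec a {v}) V < sum a V"
          using that v fin by (intro sum_strict_mono_ex1) (auto simp: dec_def)
        show "{w\<in>U. \<not> E v w} \<subseteq> V" using less.prems by auto
        show "supp (dec a {v}) \<subseteq> V" using supp_dec[of a "{v}"] supp by (rule subset_trans)
      qed
      show ?thesis using ind_sum_insert[where E = E and h = h and a = a, OF finU v(2) E] 1 2 by (auto split: if_splits)
    qed (simp add: h supp)
  qed
qed

text \<open>
  \<open>D a\<close> is the coefficient at \<open>a\<close> of the inverse of the independence polynomial with all variables
  negated.
\<close>

definition inv_coeffs :: "('v \<Rightarrow> 'v \<Rightarrow> bool) \<Rightarrow> 'v set \<Rightarrow> (('v \<Rightarrow> nat) \<Rightarrow> real) \<Rightarrow> bool" where
  "inv_coeffs E V D \<longleftrightarrow> finite V \<and> (\<forall>a b. E a b \<longrightarrow> E b a) \<and> (\<forall>a. \<not> E a a) \<and>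
     (\<forall>a. supp a \<subseteq> V \<longrightarrow> ind_sum E V D a = (if a = (\<lambda>_. 0) then 1 else 0))"

lemma inv_coeffs_ind_sum_nonneg:
  assumes "inv_coeffs E V D" "U \<subseteq> V" "supp a \<subseteq> V"
  shows "0 \<le> ind_sum E U D a"
  by (rule ind_sum_nonneg[of V]) (use assms in \<open>auto simp: inv_coeffs_def\<close>)

lemma inv_coeffs_nonneg:
  assumes "inv_coeffs E V D" "supp a \<subseteq> V"
  shows "0 \<le> D a"
  using inv_coeffs_ind_sum_nonneg[OF assms(1) empty_subsetI assms(2)] by simp

lemma inv_coeffs_0:
  assumes "inv_coeffs E V D"
  shows "D (\<lambda>_. 0) = 1"
proof -
  have "indep_supp E V (\<lambda>_. 0) = {{}}" by (auto simp: indep_supp_def indep_def)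
  then have "ind_sum E V D (\<lambda>_. 0) = D (\<lambda>_. 0)" by (simp add: ind_sum_def)
  then show ?thesis using assms by (auto simp: inv_coeffs_def supp_def)
qed

text \<open>
  Applied to $b \mapsto D(a+b) - D(a) D(b)$: the signed sum of $D(a + \cdot)$ at $b$ runs over the
  independent subsets of the support of $b$, hence is nonnegative.
\<close>

lemma inv_coeffs_supermult:
  assumes D: "inv_coeffs E V D" and a: "supp a \<subseteq> V" and b: "supp b \<subseteq> V"
  shows "D a * D b \<le> D (\<lambda>i. a i + b i)"
proof -
  have E: "finite V" "\<And>a b. E a b \<Longrightarrow> E b a" "\<And>a. \<not> E a a"
    and rec: "\<And>a. supp a \<subseteq> V \<Longrightarrow> ind_sum E V D a = (if a = (\<lambda>_. 0) then 1 else 0)"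
    using D unfolding inv_coeffs_def by blast+
  let ?h = "\<lambda>b. D (\<lambda>i. a i + b i) - D a * D b"
  have nn: "0 \<le> ind_sum E V ?h b" if "supp b \<subseteq> V" for b
  proof -
    let ?ab = "\<lambda>i. a i + b i"
    have supp: "supp ?ab \<subseteq> V" using a that by (auto simp: supp_def)
    \<comment> \<open>Positivity of \<open>b\<close> on S confines S to the support of
      \<open>b\<close>, where \<open>?ab\<close> is positive too. So the signed sum at
      \<open>b\<close> becomes one over an induced subgraph, evaluated at the sum of the two
      exponents.\<close>
    have I: "indep_supp E V b = indep_supp E (supp b) ?ab"
      using that by (auto simp: indep_supp_def indep_def supp_def)
    have "(\<lambda>i. a i + dec b S i) = dec ?ab S" if "S \<in> indep_supp E V b" for S
      using that by (auto simp: indep_supp_def dec_def fun_eq_iff)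
    then have "ind_sum E V (\<lambda>b. D (\<lambda>i. a i + b i)) b = ind_sum E (supp b) D ?ab"
      unfolding ind_sum_def I[symmetric] by (intro sum.cong) auto
    then have eq: "ind_sum E V ?h b = ind_sum E (supp b) D ?ab - D a * ind_sum E V D b"
      by (simp add: ind_sum_diff ind_sum_scale)
    \<comment> \<open>At \<open>b = 0\<close> both parts equal \<open>D a\<close> and cancel. At any
      other \<open>b\<close> the subtracted signed sum is 0.\<close>
    show ?thesis
    proof (cases "b = (\<lambda>_. 0)")
      case True
      then have "supp b = {}" by (simp add: supp_def)
      then show ?thesis using eq rec[OF that] True by simp
    next
      case False
      then show ?thesis
        using eq rec[OF that] inv_coeffs_ind_sum_nonneg[OF D that supp] by simp
    qed
  qed
  have "0 \<le> ind_sum E {} ?h b"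
    by (rule ind_sum_nonneg[where V = V and E = E, OF E nn empty_subsetI b])
  then show ?thesis by simp
qed

text \<open>The signed sums of the difference vanish over \<open>V\<close>, hence are nonnegative;
  passing to the empty vertex set gives both inequalities.\<close>

lemma inv_coeffs_unique:
  assumes D: "inv_coeffs E V D" and D': "inv_coeffs E V D'" and a: "supp a \<subseteq> V"
  shows "D a = D' a"
proof -
  have E: "finite V" "\<And>a b. E a b \<Longrightarrow> E b a" "\<And>a. \<not> E a a"
    using D unfolding inv_coeffs_def by blast+
  have le: "F a \<le> G a" if "inv_coeffs E V F" "inv_coeffs E V G" for F G
  proof -
    have "ind_sum E V (\<lambda>b. G b - F b) b = 0" if "supp b \<subseteq> V" for b
      using \<open>inv_coeffs E V F\<close> \<open>inv_coeffs E V G\<close> that by (simp add: ind_sum_diff inv_coeffs_def)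
    then have nn: "0 \<le> ind_sum E V (\<lambda>b. G b - F b) b" if "supp b \<subseteq> V" for b
      using that by simp
    have "0 \<le> ind_sum E {} (\<lambda>b. G b - F b) a"
      by (rule ind_sum_nonneg[where V = V and E = E, OF E nn empty_subsetI a])
    then show ?thesis by simp
  qed
  show ?thesis using le[OF D D'] le[OF D' D] by simp
qed

lemma ind_sum_image:
  assumes "bij \<sigma>" "\<And>x y. E (\<sigma> x) (\<sigma> y) \<longleftrightarrow> E x y"
  shows "ind_sum E (\<sigma> ` U) h a = ind_sum E U (\<lambda>b. h (b \<circ> inv \<sigma>)) (a \<circ> \<sigma>)"
proof -
  have inj: "inj \<sigma>" using assms(1) by (simp add: bij_is_inj)
  have img: "indep_supp E (\<sigma> ` U) a = (`) \<sigma> ` indep_supp E U (a \<circ> \<sigma>)"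
  proof (intro set_eqI iffI)
    fix T assume T: "T \<in> indep_supp E (\<sigma> ` U) a"
    then obtain S where S: "S \<subseteq> U" "T = \<sigma> ` S"
      unfolding indep_supp_def indep_def subset_image_iff by auto
    then have "S \<in> indep_supp E U (a \<circ> \<sigma>)"
      using T assms(2) by (auto simp: indep_supp_def indep_def)
    then show "T \<in> (`) \<sigma> ` indep_supp E U (a \<circ> \<sigma>)" using S by blast
  qed (auto simp: indep_supp_def indep_def assms(2))
  have "dec (a \<circ> \<sigma>) S \<circ> inv \<sigma> = dec a (\<sigma> ` S)" for S
  proof
    fix i
    have "inv \<sigma> i \<in> S \<longleftrightarrow> i \<in> \<sigma> ` S"
      using assms(1) by (metis bij_inv_eq_iff image_iff)
    then show "(dec (a \<circ> \<sigma>) S \<circ> inv \<sigma>) i = dec a (\<sigma> ` S) i"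
      using assms(1) by (simp add: dec_def bij_is_surj surj_f_inv_f)
  qed
  moreover have "inj_on ((`) \<sigma>) (indep_supp E U (a \<circ> \<sigma>))"
    using inj by (meson inj_image_eq_iff inj_onI)
  moreover have "card (\<sigma> ` S) = card S" for S
    using inj by (simp add: card_image inj_on_subset)
  ultimately show ?thesis
    unfolding ind_sum_def img by (simp add: sum.reindex)
qed

text \<open>The relabelled function satisfies the same defining equations, so uniqueness
  applies.\<close>

lemma inv_coeffs_automorphism:
  assumes D: "inv_coeffs E V D" and \<sigma>: "bij \<sigma>" "\<And>x y. E (\<sigma> x) (\<sigma> y) \<longleftrightarrow> E x y" "\<sigma> ` V = V"
    and a: "supp a \<subseteq> V"
  shows "D (a \<circ> inv \<sigma>) = D a"
proof (rule inv_coeffs_unique[OF _ D a])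
  have "ind_sum E V (\<lambda>b. D (b \<circ> inv \<sigma>)) b = (if b = (\<lambda>_. 0) then 1 else 0)" if "supp b \<subseteq> V" for b
  proof -
    have b: "(b \<circ> inv \<sigma>) \<circ> \<sigma> = b" using \<sigma>(1) by (simp add: comp_assoc bij_is_inj)
    have "supp (b \<circ> inv \<sigma>) \<subseteq> V"
    proof
      fix i assume "i \<in> supp (b \<circ> inv \<sigma>)"
      then have "inv \<sigma> i \<in> V" using that by (auto simp: supp_def)
      then have "\<sigma> (inv \<sigma> i) \<in> V" using \<sigma>(3) by blast
      then show "i \<in> V" using \<sigma>(1) by (simp add: bij_is_surj surj_f_inv_f)
    qed
    moreover have "b \<circ> inv \<sigma> = (\<lambda>_. 0) \<longleftrightarrow> b = (\<lambda>_. 0)"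
      by (metis (no_types, lifting) b comp_def)
    ultimately show ?thesis
      using ind_sum_image[where \<sigma> = \<sigma> and E = E and U = V and h = D and a = "b \<circ> inv \<sigma>", OF \<sigma>(1,2)] D
      unfolding b \<sigma>(3) inv_coeffs_def by simp
  qed
  then show "inv_coeffs E V (\<lambda>b. D (b \<circ> inv \<sigma>))"
    using D unfolding inv_coeffs_def by blast
qed

section \<open>Sums over exponents of fixed degree\<close>

definition exps :: "'v set \<Rightarrow> nat \<Rightarrow> ('v \<Rightarrow> nat) set" where
  "exps V k = {a. supp a \<subseteq> V \<and> sum a V = k}"

lemma exps_outside: "a \<in> exps V k \<Longrightarrow> i \<notin> V \<Longrightarrow> a i = 0"
  by (auto simp: exps_def supp_def)

text \<open>A crude polynomial bound on the number of exponents suffices, since growth rates matter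
  only up to powers of k.\<close>

lemma exps_bounded:
  assumes "finite V"
  shows "finite (exps V k)" "card (exps V k) \<le> (k + 1) ^ card V"
proof -
  let ?r = "\<lambda>a. restrict a V"
  have inj: "inj_on ?r (exps V k)"
  proof (rule inj_onI)
    fix a b :: "'a \<Rightarrow> nat" assume ab: "a \<in> exps V k" "b \<in> exps V k" "?r a = ?r b"
    show "a = b"
    proof
      fix i
      show "a i = b i"
        using ab(1,2) fun_cong[OF ab(3), of i] by (cases "i \<in> V") (auto simp: exps_outside)
    qed
  qed
  have sub: "?r ` exps V k \<subseteq> V \<rightarrow>\<^sub>E {..k}"
  proof (rule image_subsetI)
    fix a assume "a \<in> exps V k"
    then have "a i \<le> k" if "i \<in> V" for i
      using member_le_sum[OF that, of a] assms by (auto simp: exps_def)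
    then show "?r a \<in> V \<rightarrow>\<^sub>E {..k}" by auto
  qed
  have fin: "finite (V \<rightarrow>\<^sub>E {..k})" using assms by (simp add: finite_PiE)
  show "finite (exps V k)" using inj sub fin finite_imageD finite_subset by blast
  have "card (exps V k) = card (?r ` exps V k)" using inj by (simp add: card_image)
  also have "\<dots> \<le> card (V \<rightarrow>\<^sub>E {..k})" using sub fin by (rule card_mono[rotated])
  also have "\<dots> = (k + 1) ^ card V" using assms by (simp add: card_PiE)
  finally show "card (exps V k) \<le> (k + 1) ^ card V" .
qed

text \<open>When \<open>D\<close> lists the coefficients of 1/I_V(-x), this is the coefficient of
  t^k in I_U(-t)/I_V(-t), all variables having been set equal to t.\<close>

definition level_sum :: "('v \<Rightarrow> 'v \<Rightarrow> bool) \<Rightarrow> 'v set \<Rightarrow> (('v \<Rightarrow> nat) \<Rightarrow> real) \<Rightarrow> 'v set \<Rightarrow> nat \<Rightarrow> real" where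
  "level_sum E V D U k = (\<Sum>a\<in>exps V k. ind_sum E U D a)"

lemma sum_exps_dec:
  assumes "finite V" "v \<in> V"
  shows "(\<Sum>a\<in>exps V k. if 0 < a v then g (dec a {v}) else 0) =
    (if 0 < k then \<Sum>b\<in>exps V (k - 1). g b else (0::real))"
proof -
  have split: "sum a V = a v + sum a (V - {v})" for a :: "'a \<Rightarrow> nat"
    using assms by (simp add: sum.remove)
  have rest: "sum (b(v := x)) (V - {v}) = sum b (V - {v})" "sum (dec b {v}) (V - {v}) = sum b (V - {v})"
    for b :: "'a \<Rightarrow> nat" and x
    by (auto intro!: sum.cong simp: dec_def)
  have "(\<Sum>a\<in>exps V k. if 0 < a v then g (dec a {v}) else 0) =
      (\<Sum>a\<in>{a\<in>exps V k. 0 < a v}. g (dec a {v}))"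
    using exps_bounded(1)[OF assms(1)] by (intro sum.inter_filter[symmetric])
  also have "\<dots> = (if 0 < k then \<Sum>b\<in>exps V (k - 1). g b else 0)"
  proof (cases "0 < k")
    case True
    have "(\<Sum>a\<in>{a\<in>exps V k. 0 < a v}. g (dec a {v})) = (\<Sum>b\<in>exps V (k - 1). g b)"
    proof (rule sum.reindex_bij_witness[where i = "\<lambda>b. b(v := b v + 1)" and j = "\<lambda>a. dec a {v}"])
      fix a assume a: "a \<in> {a\<in>exps V k. 0 < a v}"
      show "(dec a {v})(v := dec a {v} v + 1) = a"
        using a by (auto simp: dec_def fun_eq_iff)
      show "dec a {v} \<in> exps V (k - 1)"
        using a supp_dec[of a "{v}"] by (auto simp: exps_def split[of a] split[of "dec a {v}"] rest dec_def[of _ _ v])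
    next
      fix b assume b: "b \<in> exps V (k - 1)"
      show "dec (b(v := b v + 1)) {v} = b" by (auto simp: dec_def fun_eq_iff)
      have "sum (b(v := b v + 1)) V = b v + 1 + sum b (V - {v})"
        using split[of "b(v := b v + 1)"] by (simp only: rest fun_upd_same)
      then have "sum (b(v := b v + 1)) V = k"
        using b True split[of b] unfolding exps_def by simp
      moreover have "supp (b(v := b v + 1)) \<subseteq> V"
        using b assms(2) by (auto simp: exps_def supp_def)
      ultimately show "b(v := b v + 1) \<in> {a\<in>exps V k. 0 < a v}" by (simp add: exps_def)
    qed simp
    then show ?thesis using True by simp
  next
    case False
    then have empty: "{a\<in>exps V k. 0 < a v} = {}" using assms by (auto simp: exps_def)
    show ?thesis unfolding empty using False by simp
  qed
  finally show ?thesis .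
qed

lemma level_sum_insert:
  assumes D: "inv_coeffs E V D" and "v \<in> V" "v \<notin> W" "W \<subseteq> V"
  shows "level_sum E V D W k = level_sum E V D (insert v W) k +
    (if 0 < k then level_sum E V D {w\<in>W. \<not> E v w} (k - 1) else 0)"
proof -
  have E: "finite V" "\<And>a b. E a b \<Longrightarrow> E b a" "\<And>a. \<not> E a a"
    using D unfolding inv_coeffs_def by blast+
  have "finite W" using E(1) assms(4) finite_subset by blast
  then show ?thesis
    unfolding level_sum_def
    by (simp add: ind_sum_insert[where E = E, OF _ assms(3) E(2,3)] sum_subtractf sum_exps_dec[OF E(1) assms(2)])
qed

lemma level_sum_all:
  assumes D: "inv_coeffs E V D"
  shows "level_sum E V D V k = (if k = 0 then 1 else 0)"
proof -
  have fin: "finite V" using D by (simp add: inv_coeffs_def)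
  have "level_sum E V D V k = (\<Sum>a\<in>exps V k. if a = (\<lambda>_. 0) then 1 else 0)"
    unfolding level_sum_def using D by (intro sum.cong) (auto simp: inv_coeffs_def exps_def)
  also have "\<dots> = (if (\<lambda>_. 0) \<in> exps V k then 1 else 0)"
    using exps_bounded(1)[OF fin] by simp
  also have "(\<lambda>_. 0) \<in> exps V k \<longleftrightarrow> k = 0" by (auto simp: exps_def supp_def)
  finally show ?thesis .
qed

lemma level_sum_automorphism:
  assumes D: "inv_coeffs E V D" and \<sigma>: "bij \<sigma>" "\<And>x y. E (\<sigma> x) (\<sigma> y) \<longleftrightarrow> E x y" "\<sigma> ` V = V"
  shows "level_sum E V D (\<sigma> ` U) k = level_sum E V D U k"
proof -
  have inV: "\<sigma> i \<in> V \<longleftrightarrow> i \<in> V" for i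
    using \<sigma>(1,3) by (metis bij_is_inj inj_image_mem_iff)
  have s: "sum (a \<circ> \<sigma>) V = sum a V" for a :: "'a \<Rightarrow> nat"
    using sum.reindex[of \<sigma> V a] \<sigma> by (metis bij_is_inj inj_on_subset subset_UNIV)
  have e1: "a \<circ> \<sigma> \<in> exps V k" if "a \<in> exps V k" for a
  proof -
    have "supp (a \<circ> \<sigma>) \<subseteq> V"
      using that inV by (fastforce simp: exps_def supp_def)
    then show ?thesis using that by (simp only: exps_def mem_Collect_eq s)
  qed
  have inv1: "(b \<circ> inv \<sigma>) \<circ> \<sigma> = b" "(b \<circ> \<sigma>) \<circ> inv \<sigma> = b" for b :: "'a \<Rightarrow> nat"
    using \<sigma>(1) by (simp_all add: fun_eq_iff bij_is_inj bij_is_surj surj_f_inv_f)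
  have e2: "a \<circ> inv \<sigma> \<in> exps V k" if "a \<in> exps V k" for a
  proof -
    have "sum (a \<circ> inv \<sigma>) V = sum a V" using s[of "a \<circ> inv \<sigma>"] by (simp add: inv1)
    moreover have "supp (a \<circ> inv \<sigma>) \<subseteq> V"
      using that inV \<sigma>(1) by (auto simp: exps_def supp_def) (metis bij_is_surj inV surj_f_inv_f subset_iff mem_Collect_eq)
    ultimately show ?thesis using that by (simp only: exps_def mem_Collect_eq)
  qed
  have "level_sum E V D (\<sigma> ` U) k = (\<Sum>a\<in>exps V k. ind_sum E U D (a \<circ> \<sigma>))"
    unfolding level_sum_def
  proof (intro sum.cong refl)
    fix a assume "a \<in> exps V k"
    then have "supp (a \<circ> \<sigma>) \<subseteq> V" using e1 by (auto simp: exps_def)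
    then show "ind_sum E (\<sigma> ` U) D a = ind_sum E U D (a \<circ> \<sigma>)"
      unfolding ind_sum_image[where \<sigma> = \<sigma> and E = E, OF \<sigma>(1,2)]
      by (intro ind_sum_cong inv_coeffs_automorphism[OF D \<sigma>]) auto
  qed
  also have "\<dots> = level_sum E V D U k"
    unfolding level_sum_def
    by (rule sum.reindex_bij_witness[where i = "\<lambda>b. b \<circ> inv \<sigma>" and j = "\<lambda>a. a \<circ> \<sigma>"])
       (simp_all only: e1 e2 inv1)
  finally show ?thesis .
qed

section \<open>Growth of the coefficients for a cycle\<close>

text \<open>Extended by the identity beyond \<open>n\<close>, because automorphisms are taken to be
  bijections of the whole type.\<close>

definition rot :: "nat \<Rightarrow> nat \<Rightarrow> nat" where
  "rot n i = (if i < n then (i + 1) mod n else i)"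

lemma rot_cycle:
  assumes "n \<ge> 3"
  shows "bij (rot n)" "rot n ` {..<n} = {..<n}" "cycle_adj n (rot n x) (rot n y) \<longleftrightarrow> cycle_adj n x y"
proof -
  have inj: "x = y" if "rot n x = rot n y" for x y
    using that assms by (auto simp: rot_def mod_Suc split: if_splits)
  have sub: "rot n ` {..<n} \<subseteq> {..<n}" using assms by (auto simp: rot_def)
  moreover have "inj_on (rot n) {..<n}" using inj by (auto intro: inj_onI)
  ultimately show img: "rot n ` {..<n} = {..<n}" by (simp add: endo_inj_surj)
  have "y \<in> range (rot n)" for y
  proof (cases "y < n")
    case True
    then show ?thesis using img by blast
  next
    case False
    then have "rot n y = y" by (simp add: rot_def)
    then show ?thesis by (metis rangeI)
  qed
  then show "bij (rot n)" using inj by (auto intro!: bijI injI)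
  have lt: "rot n x < n \<longleftrightarrow> x < n" for x using assms by (auto simp: rot_def)
  have "rot n y = (rot n x + 1) mod n \<longleftrightarrow> y = (x + 1) mod n" if "x < n" "y < n" for x y
    using that assms inj[of y "(x + 1) mod n"] by (auto simp: rot_def)
  then show "cycle_adj n (rot n x) (rot n y) \<longleftrightarrow> cycle_adj n x y"
    unfolding cycle_adj_def lt by blast
qed

lemma rot_funpow: "i < n \<Longrightarrow> (rot n ^^ j) i = (i + j) mod n"
  by (induction j) (simp_all add: rot_def mod_simps)

lemma sum_rotations:
  fixes a :: "nat \<Rightarrow> nat"
  assumes "i < n"
  shows "(\<Sum>j<n. a ((i + j) mod n)) = sum a {..<n}"
proof (rule sum.reindex_bij_witness[where i = "\<lambda>l. (l + (n - i)) mod n" and j = "\<lambda>j. (i + j) mod n"])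
  fix j assume j: "j \<in> {..<n}"
  have "((i + j) mod n + (n - i)) mod n = (i + j + (n - i)) mod n"
    by (rule mod_add_left_eq)
  also have "i + j + (n - i) = j + n" using assms by simp
  finally have "((i + j) mod n + (n - i)) mod n = (j + n) mod n" .
  then show "((i + j) mod n + (n - i)) mod n = j" using j by simp
next
  fix l assume l: "l \<in> {..<n}"
  have "(i + (l + (n - i)) mod n) mod n = (i + (l + (n - i))) mod n"
    by (rule mod_add_right_eq)
  also have "i + (l + (n - i)) = l + n" using assms by simp
  finally have "(i + (l + (n - i)) mod n) mod n = (l + n) mod n" .
  then show "(i + (l + (n - i)) mod n) mod n = l" using l by simp
qed (use assms in auto)

text \<open>The numbers \<open>w i * (1 / z) ^ k\<close> solve exactly the deletion recursion for
  the level sums of the paths \<open>{..<i}\<close>; the condition on \<open>w (n - 1)\<close> makes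
  the full cycle contribute 0, as it does in positive degree. The recursion has nonnegative
  coefficients, so the bounds in degree 0 propagate from degree to degree and, within a degree,
  downwards in \<open>i\<close>.\<close>

lemma cycle_level_bounds:
  assumes n: "n \<ge> 4" and D: "inv_coeffs (cycle_adj n) {..<n} D"
    and z: "z > 0"
    and w: "\<And>i. i < n \<Longrightarrow> w i > 0" "\<And>i. i < n - 1 \<Longrightarrow> w i = w (i + 1) + z * w (i - 1)"
      "w (n - 1) = z * w (n - 3)"
    and cC: "\<And>i. i < n \<Longrightarrow> c * w i \<le> 1" "\<And>i. i < n \<Longrightarrow> 1 \<le> C * w i"
    and i: "i < n"
  shows "c * w i * (1 / z) ^ k \<le> level_sum (cycle_adj n) {..<n} D {..<i} k \<and>
    level_sum (cycle_adj n) {..<n} D {..<i} k \<le> C * w i * (1 / z) ^ k"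
proof -
  define B where "B i k = level_sum (cycle_adj n) {..<n} D {..<i} k" for i k
  have Bn: "B n k = (if k = 0 then 1 else 0)" for k
    unfolding B_def by (rule level_sum_all[OF D])
  \<comment> \<open>The only neighbour of \<open>i\<close> to be removed is \<open>i - 1\<close>.
    For \<open>i = 0\<close> the truncated subtraction leaves the empty path, as it should.\<close>
  have step: "B i k = B (i + 1) k + (if 0 < k then B (i - 1) (k - 1) else 0)" if "i < n - 1" for i k
  proof -
    have "{w \<in> {..<i}. \<not> cycle_adj n i w} = {..<i - 1}"
    proof (intro set_eqI)
      fix w
      show "w \<in> {w \<in> {..<i}. \<not> cycle_adj n i w} \<longleftrightarrow> w \<in> {..<i - 1}"
      proof (cases "w < i")
        case True
        then have "cycle_adj n i w \<longleftrightarrow> i = Suc w"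
          using that n cycle_adj_iff[of n w i] cycle_adj_sym[of n i w] by auto
        then show ?thesis using True by auto
      qed auto
    qed
    then show ?thesis
      using level_sum_insert[OF D, of i "{..<i}" k] that unfolding B_def
      by (simp add: lessThan_Suc[symmetric])
  qed
  \<comment> \<open>The vertex \<open>n - 1\<close> closes the cycle and is adjacent to
    \<open>n - 2\<close> and 0. What remains, 1, ..., n - 3, is a rotated path with
    \<open>n - 3\<close> vertices.\<close>
  have last: "B (n - 1) k = B n k + (if 0 < k then B (n - 3) (k - 1) else 0)" for k
  proof -
    have "{w \<in> {..<n - 1}. \<not> cycle_adj n (n - 1) w} = rot n ` {..<n - 3}"
    proof (intro set_eqI)
      fix w
      have img: "w \<in> rot n ` {..<n - 3} \<longleftrightarrow> 0 < w \<and> w < n - 2"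
      proof
        assume "0 < w \<and> w < n - 2"
        then have "w = rot n (w - 1)" "w - 1 \<in> {..<n - 3}" using n by (auto simp: rot_def)
        then show "w \<in> rot n ` {..<n - 3}" by blast
      qed (use n in \<open>auto simp: rot_def\<close>)
      show "w \<in> {w \<in> {..<n - 1}. \<not> cycle_adj n (n - 1) w} \<longleftrightarrow> w \<in> rot n ` {..<n - 3}"
      proof (cases "w < n - 1")
        case True
        then have "cycle_adj n (n - 1) w \<longleftrightarrow> n - 1 = Suc w \<or> w = 0"
          using n cycle_adj_iff[of n w "n - 1"] cycle_adj_sym[of n "n - 1" w] by auto
        then show ?thesis unfolding img using True by auto
      next
        case False
        then show ?thesis unfolding img by auto
      qed
    qed
    moreover have "insert (n - 1) {..<n - 1} = {..<n}" using n by auto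
    moreover have "level_sum (cycle_adj n) {..<n} D (rot n ` {..<n - 3}) (k - 1) = B (n - 3) (k - 1)"
      unfolding B_def using n by (intro level_sum_automorphism[OF D] rot_cycle) auto
    ultimately show ?thesis
      using level_sum_insert[OF D, of "n - 1" "{..<n - 1}" k] n unfolding B_def by auto
  qed
  have "c * w i * (1 / z) ^ k \<le> B i k \<and> B i k \<le> C * w i * (1 / z) ^ k" if "i < n" for i k
    using that
  proof (induction k arbitrary: i)
    case 0
    have "B i 0 = 1" if "i \<le> n" for i
      using that
    proof (induction "n - i" arbitrary: i)
      case (Suc d)
      then have "B (i + 1) 0 = 1" by simp
      moreover have "B i 0 = B (i + 1) 0"
        using step[of i 0] last[of 0] Suc n by (cases "i = n - 1") auto
      ultimately show ?case by simp
    qed (simp add: Bn)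
    then show ?case using cC 0 by simp
  next
    case (Suc k)
    note outer = Suc.IH
    show ?case
      using Suc.prems
    proof (induction "n - 1 - i" arbitrary: i)
      case 0
      then have i: "i = n - 1" by simp
      have "w (n - 1) * (1 / z) = w (n - 3)" using w(3) z by simp
      then have "x * w (n - 1) * (1 / z) ^ Suc k = x * w (n - 3) * (1 / z) ^ k" for x
        by (metis (no_types, lifting) mult.assoc mult.commute power_Suc)
      then show ?case using last[of "Suc k"] Bn outer[of "n - 3"] n unfolding i by simp
    next
      case (Suc d)
      then have i: "i < n - 1" by simp
      have eq: "x * w i * (1 / z) ^ Suc k = x * w (i + 1) * (1 / z) ^ Suc k + x * w (i - 1) * (1 / z) ^ k" for x
        unfolding w(2)[OF i] using z by (simp add: field_simps)
      have B: "B i (Suc k) = B (i + 1) (Suc k) + B (i - 1) k" using step[OF i, of "Suc k"] by simp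
      have "d = n - 1 - (i + 1)" "i + 1 < n" "i - 1 < n" using Suc(2) i by auto
      then have "c * w (i + 1) * (1 / z) ^ Suc k \<le> B (i + 1) (Suc k)" "B (i + 1) (Suc k) \<le> C * w (i + 1) * (1 / z) ^ Suc k"
        "c * w (i - 1) * (1 / z) ^ k \<le> B (i - 1) k" "B (i - 1) k \<le> C * w (i - 1) * (1 / z) ^ k"
        using Suc(1)[of "i + 1"] outer[of "i - 1"] by blast+
      then show ?case unfolding eq B by (simp only: add_mono)
    qed
  qed
  from this[OF i] show ?thesis by (simp add: B_def)
qed

text \<open>In the sum of the n rotations of \<open>a\<close> each coordinate collects every entry
  of \<open>a\<close> once, so it equals k. All rotations have the same value under
  \<open>D\<close>, and \<open>D\<close> is supermultiplicative.\<close>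

lemma cycle_diagonal_lower:
  assumes n: "n \<ge> 3" and D: "inv_coeffs (cycle_adj n) {..<n} D" and a: "a \<in> exps {..<n} k"
  shows "D a ^ n \<le> D (\<lambda>i. if i < n then k else 0)"
proof -
  let ?a = "\<lambda>j. a \<circ> (rot n ^^ j)"
  have supp: "supp (?a j) \<subseteq> {..<n}" for j
  proof -
    have "(rot n ^^ j) i = i" if "i \<ge> n" for i
      using that by (induction j) (auto simp: rot_def)
    then show ?thesis using a by (auto simp: exps_def supp_def subset_iff) (metis not_le)
  qed
  have same: "D (?a j) = D a" for j
  proof (induction j)
    case (Suc j)
    have "?a (Suc j) \<circ> inv (rot n) = ?a j"
      using rot_cycle(1)[OF n]
      by (metis comp_assoc comp_id funpow.simps(2) funpow_swap1 bij_is_surj surj_iff funpow_Suc_right)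
    moreover have "D (?a (Suc j) \<circ> inv (rot n)) = D (?a (Suc j))"
      by (rule inv_coeffs_automorphism[OF D rot_cycle(1,3,2)[OF n] supp])
    ultimately show ?case using Suc by (simp only:)
  qed simp
  have "(\<Prod>j<m. D (?a j)) \<le> D (\<lambda>i. \<Sum>j<m. ?a j i)" for m
  proof (induction m)
    case 0
    then show ?case using inv_coeffs_0[OF D] by simp
  next
    case (Suc m)
    have s: "supp (\<lambda>i. \<Sum>j<m. ?a j i) \<subseteq> {..<n}"
    proof
      fix i assume "i \<in> supp (\<lambda>i. \<Sum>j<m. ?a j i)"
      then obtain j where "?a j i \<noteq> 0" by (auto simp: supp_def)
      then show "i \<in> {..<n}" using supp[of j] by (auto simp: supp_def)
    qed
    have "(\<Prod>j<Suc m. D (?a j)) = (\<Prod>j<m. D (?a j)) * D (?a m)"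
      by (rule prod.lessThan_Suc)
    also have "\<dots> \<le> D (\<lambda>i. \<Sum>j<m. ?a j i) * D (?a m)"
      by (rule mult_right_mono[OF Suc.IH inv_coeffs_nonneg[OF D supp]])
    also have "\<dots> \<le> D (\<lambda>i. (\<Sum>j<m. ?a j i) + ?a m i)"
      by (rule inv_coeffs_supermult[OF D s supp])
    finally show ?case by (simp only: sum.lessThan_Suc)
  qed
  from this[of n] have "D a ^ n \<le> D (\<lambda>i. \<Sum>j<n. ?a j i)" by (simp add: same)
  also have "(\<lambda>i. \<Sum>j<n. ?a j i) = (\<lambda>i. if i < n then k else 0)"
  proof
    fix i
    show "(\<Sum>j<n. ?a j i) = (if i < n then k else 0)"
    proof (cases "i < n")
      case True
      then show ?thesis using sum_rotations[of i n a] a by (simp add: rot_funpow exps_def)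
    next
      case False
      have "?a j i = 0" for j
        using supp[of j] False by (auto simp: supp_def)
      then show ?thesis using False by simp
    qed
  qed
  finally show ?thesis .
qed

text \<open>
  Up to a constant factor, \<open>w i\<close> is the value at \<open>- z\<close> of the univariate independence polynomial of
  the path with \<open>i\<close> vertices.
\<close>

lemma cycle_weights:
  assumes n: "n \<ge> 4"
  defines "\<theta> \<equiv> pi / (2 * real n)"
  defines "w \<equiv> \<lambda>i. sin ((real i + 2) * \<theta>) / (2 * cos \<theta>) ^ i"
  defines "z \<equiv> 1 / (2 * cos \<theta>)\<^sup>2"
  shows "z > 0" "\<And>i. i < n \<Longrightarrow> w i > 0" "\<And>i. w i = w (i + 1) + z * w (i - 1)" "w (n - 1) = z * w (n - 3)"
proof -
  have \<theta>: "0 < \<theta>" "2 * (real n * \<theta>) = pi" using n by (auto simp: \<theta>_def)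
  have "\<theta> < pi / 2" using n by (simp add: \<theta>_def field_simps)
  then have cos: "cos \<theta> > 0" using \<theta> by (intro cos_gt_zero)
  then show "z > 0" by (simp add: z_def)
  \<comment> \<open>The angle stays below pi because i + 2 < 2n.\<close>
  show "w i > 0" if "i < n" for i
  proof -
    have "(real i + 2) < 2 * real n" using that n by simp
    then have "(real i + 2) * \<theta> < 2 * real n * \<theta>" using \<theta>(1) by (rule mult_strict_right_mono)
    moreover have "2 * real n * \<theta> = pi" using \<theta> by simp
    ultimately have "sin ((real i + 2) * \<theta>) > 0" using \<theta>(1) by (intro sin_gt_zero) auto
    then show ?thesis using cos by (simp add: w_def)
  qed
  have add: "sin (x + \<theta>) + sin (x - \<theta>) = sin x * (2 * cos \<theta>)" for x
    by (simp add: sin_add sin_diff)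
  show "w i = w (i + 1) + z * w (i - 1)" for i
  \<comment> \<open>For \<open>i = 0\<close> truncated subtraction turns the claim into
    \<open>w 0 = w 1 + z * w 0\<close>. The offset 2 in the angle makes it true: w(0) =
    sin(2\<theta>) = 2 cos(\<theta>) sin(\<theta>) is also the value of the formula at -1.\<close>
  proof (cases i)
    case 0
    have "sin (2 * \<theta> + \<theta>) + sin (2 * \<theta> - \<theta>) = sin (2 * \<theta>) * (2 * cos \<theta>)" by (rule add)
    then have "sin (3 * \<theta>) + sin \<theta> = sin (2 * \<theta>) * (2 * cos \<theta>)" by (simp add: algebra_simps)
    moreover have "sin (2 * \<theta>) = sin \<theta> * (2 * cos \<theta>)" by (simp add: sin_double)
    ultimately show ?thesis
      unfolding w_def z_def 0 using cos by (simp add: field_simps power2_eq_square)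
  next
    case (Suc j)
    have "sin ((real i + 2) * \<theta> + \<theta>) + sin ((real i + 2) * \<theta> - \<theta>) = sin ((real i + 2) * \<theta>) * (2 * cos \<theta>)" by (rule add)
    then have "sin ((real (i + 1) + 2) * \<theta>) + sin ((real (i - 1) + 2) * \<theta>) = sin ((real i + 2) * \<theta>) * (2 * cos \<theta>)"
      unfolding Suc by (simp add: algebra_simps)
    then show ?thesis
      unfolding w_def z_def using cos Suc by (simp add: field_simps power2_eq_square)
  qed
  \<comment> \<open>The angles (n + 1)\<theta> and (n - 1)\<theta> add up to pi; this is where the
    value of \<theta> comes from. The resulting equation says that -z is a root of the independence
    polynomial of the cycle.\<close>
  have "sin ((real (n - 1) + 2) * \<theta>) = sin (pi - (real (n - 1) + 2) * \<theta>)" by simp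
  also have "pi - (real (n - 1) + 2) * \<theta> = (real (n - 3) + 2) * \<theta>"
    unfolding \<theta>(2)[symmetric] using n by (simp add: of_nat_diff algebra_simps)
  finally have "sin ((real (n - 1) + 2) * \<theta>) = sin ((real (n - 3) + 2) * \<theta>)" .
  moreover have "(2 * cos \<theta>) ^ (n - 1) = (2 * cos \<theta>)\<^sup>2 * (2 * cos \<theta>) ^ (n - 3)"
  proof -
    have "n - 1 = 2 + (n - 3)" using n by simp
    then show ?thesis by (simp only: power_add)
  qed
  ultimately show "w (n - 1) = z * w (n - 3)"
    by (simp add: w_def z_def)
qed

lemma cycle_diagonal_growth:
  assumes n: "n \<ge> 4" and D: "inv_coeffs (cycle_adj n) {..<n} D"
  defines "\<mu> \<equiv> (2 * cos (pi / (2 * real n))) ^ (2 * n)"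
  shows "\<exists>c>0. \<exists>C s. \<forall>k. c * \<mu> ^ k / (real k + 1) ^ s \<le> D (\<lambda>i. if i < n then k else 0) \<and>
     D (\<lambda>i. if i < n then k else 0) \<le> C * \<mu> ^ k"
proof -
  define \<theta> where "\<theta> = pi / (2 * real n)"
  define w where "w i = sin ((real i + 2) * \<theta>) / (2 * cos \<theta>) ^ i" for i
  define z where "z = 1 / (2 * cos \<theta>)\<^sup>2"
  note W = cycle_weights[OF n, folded \<theta>_def, folded w_def z_def]
  \<comment> \<open>The constants are fitted in degree 0, where all level sums of the paths are
    1.\<close>
  define c where "c = Min ((\<lambda>i. 1 / w i) ` {..<n})"
  define C where "C = Max ((\<lambda>i. 1 / w i) ` {..<n})"
  have ne: "{..<n} \<noteq> {}" using n by (auto simp: lessThan_empty_iff)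
  have c0: "c > 0" unfolding c_def using ne W(2) by (subst Min_gr_iff) auto
  have c: "c * w i \<le> 1" if "i < n" for i
  proof -
    have "c \<le> 1 / w i" unfolding c_def using that by (intro Min_le) auto
    then show ?thesis using W(2)[OF that] by (simp add: field_simps)
  qed
  have C: "1 \<le> C * w i" if "i < n" for i
  proof -
    have "1 / w i \<le> C" unfolding C_def using that by (intro Max_ge) auto
    then show ?thesis using W(2)[OF that] by (simp add: field_simps)
  qed
  define \<beta> where "\<beta> = 1 / z"
  have \<beta>: "\<beta> > 0" using W(1) by (simp add: \<beta>_def)
  have \<mu>: "\<mu> = \<beta> ^ n" by (simp add: \<mu>_def \<beta>_def z_def \<theta>_def power_mult)
  let ?S = "level_sum (cycle_adj n) {..<n} D {}"
  have S: "c * w 0 * \<beta> ^ k \<le> ?S k" "?S k \<le> C * w 0 * \<beta> ^ k" for k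
    using cycle_level_bounds[OF n D W(1,2,3,4) c C, of 0 k] n by (auto simp: \<beta>_def)
  have S_sum: "?S k = sum D (exps {..<n} k)" for k by (simp add: level_sum_def)
  have nonneg: "0 \<le> D a" if "a \<in> exps {..<n} k" for a k
    using that inv_coeffs_nonneg[OF D] by (simp add: exps_def)
  have w0: "w 0 > 0" using W(2) n by simp
  have upper: "D (\<lambda>i. if i < n then k else 0) \<le> C * w 0 * \<mu> ^ k" for k
  proof -
    have "(\<lambda>i. if i < n then k else 0) \<in> exps {..<n} (n * k)"
      by (auto simp: exps_def supp_def)
    then have "D (\<lambda>i. if i < n then k else 0) \<le> ?S (n * k)"
      unfolding S_sum using nonneg exps_bounded(1) by (intro member_le_sum) auto
    also have "\<dots> \<le> C * w 0 * \<beta> ^ (n * k)" by (rule S)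
    finally show ?thesis by (simp add: \<mu> power_mult)
  qed
  have lower: "(c * w 0) ^ n * \<mu> ^ k / (real k + 1) ^ (n * n) \<le> D (\<lambda>i. if i < n then k else 0)" for k
  proof -
    \<comment> \<open>A lower bound for the average: a total of at least
      \<open>c * w 0 * \<beta> ^ k\<close> is spread over at most (k + 1)^n exponents. Taking the
      n-th power below produces the exponent \<open>n * n\<close>.\<close>
    let ?t = "c * w 0 * \<beta> ^ k / (real k + 1) ^ n"
    have "\<exists>a\<in>exps {..<n} k. ?t \<le> D a"
    proof (rule ccontr)
      assume "\<not> ?thesis"
      then have lt: "D a < ?t" if "a \<in> exps {..<n} k" for a using that by force
      have t0: "?t > 0" using c0 w0 \<beta> by simp
      have "0 < ?S k" using S(1)[of k] c0 w0 \<beta> by (smt (verit) mult_pos_pos zero_less_power)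
      then have ne: "exps {..<n} k \<noteq> {}" unfolding S_sum by auto
      have "?S k < (\<Sum>a\<in>exps {..<n} k. ?t)"
        unfolding S_sum using lt ne exps_bounded(1) by (intro sum_strict_mono) auto
      also have "\<dots> = real (card (exps {..<n} k)) * ?t" by simp
      also have "\<dots> \<le> real ((k + 1) ^ n) * ?t"
        using exps_bounded(2)[OF finite_lessThan, of n k] t0
        by (intro mult_right_mono) (simp_all only: of_nat_le_iff card_lessThan less_imp_le)
      also have "\<dots> = c * w 0 * \<beta> ^ k" by (simp add: add.commute)
      finally show False using S(1)[of k] by simp
    qed
    then obtain a where a: "a \<in> exps {..<n} k" "?t \<le> D a" by blast
    have "?t ^ n \<le> D a ^ n" using a c0 w0 \<beta> by (intro power_mono) auto
    also have "\<dots> \<le> D (\<lambda>i. if i < n then k else 0)"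
      using cycle_diagonal_lower[OF _ D a(1)] n by simp
    also have "?t ^ n = (c * w 0) ^ n * \<mu> ^ k / (real k + 1) ^ (n * n)"
      by (simp add: \<mu> power_mult_distrib power_divide power_mult[symmetric] mult.commute)
    finally show ?thesis .
  qed
  have "(c * w 0) ^ n > 0" using c0 w0 by simp
  then show ?thesis using upper lower by blast
qed

section \<open>Rational term ratios\<close>

lemma power_quotient_tendsto_0:
  assumes "i < d"
  shows "(\<lambda>k. real k ^ i / real k ^ d) \<longlonglongrightarrow> 0"
proof -
  have "(\<lambda>k. inverse (real k) ^ (d - i)) \<longlonglongrightarrow> 0 ^ (d - i)"
    by (intro tendsto_power lim_inverse_n)
  moreover have "inverse (real k) ^ (d - i) = real k ^ i / real k ^ d" for k
  proof (cases "k = 0")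
    case False
    then show ?thesis using assms by (simp add: power_diff power_inverse field_simps)
  qed (use assms in \<open>simp add: power_0_left\<close>)
  moreover have "0 ^ (d - i) = (0::real)" using assms by (simp add: power_0_left)
  ultimately show ?thesis by (simp only:)
qed

lemma poly_div_power_tendsto:
  fixes p :: "real poly"
  shows "(\<lambda>k. poly p (real k) / real k ^ degree p) \<longlonglongrightarrow> lead_coeff p"
proof -
  have "(\<lambda>k. real k ^ i / real k ^ degree p) \<longlonglongrightarrow> (if i = degree p then 1 else 0)" if "i \<le> degree p" for i
  proof (cases "i = degree p")
    case True
    have "\<forall>\<^sub>F k in sequentially. real k ^ i / real k ^ degree p = 1"
      using eventually_gt_at_top[of 0] by eventually_elim (simp add: True)
    then show ?thesis using True by (simp add: tendsto_eventually)
  next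
    case False
    then have "i < degree p" using that by simp
    then have "(\<lambda>k. real k ^ i / real k ^ degree p) \<longlonglongrightarrow> 0" by (rule power_quotient_tendsto_0)
    then show ?thesis using False by simp
  qed
  then have "(\<lambda>k. \<Sum>i\<le>degree p. coeff p i * (real k ^ i / real k ^ degree p)) \<longlonglongrightarrow>
      (\<Sum>i\<le>degree p. coeff p i * (if i = degree p then 1 else 0))"
    by (intro tendsto_sum tendsto_mult tendsto_const) auto
  also have "(\<Sum>i\<le>degree p. coeff p i * (if i = degree p then 1 else 0)) = lead_coeff p"
    by (simp add: if_distrib cong: if_cong)
  also have "(\<lambda>k. \<Sum>i\<le>degree p. coeff p i * (real k ^ i / real k ^ degree p)) =
      (\<lambda>k. poly p (real k) / real k ^ degree p)"
    by (simp add: poly_altdef sum_divide_distrib)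
  finally show ?thesis .
qed

lemma power_times_geometric_tendsto_0:
  fixes x :: real
  assumes "0 < x" "x < 1"
  shows "(\<lambda>k. (real k + 1) ^ s * x ^ k) \<longlonglongrightarrow> 0"
proof -
  \<comment> \<open>With y^(s+1) = x the sequence is dominated by ((k + 1) y^k)^(s+1). The root of
    order s + 1 rather than s covers \<open>s = 0\<close> as well.\<close>
  define y where "y = root (Suc s) x"
  have y: "0 < y" "y < 1" "y ^ Suc s = x"
    using assms real_root_pow_pos2[of "Suc s" x] by (simp_all add: y_def)
  have "(\<lambda>k. real k * y ^ k) \<longlonglongrightarrow> 0"
    using y by (intro powser_times_n_limit_0) simp
  moreover have "(\<lambda>k. y ^ k) \<longlonglongrightarrow> 0"
    using y by (intro LIMSEQ_power_zero) simp
  ultimately have "(\<lambda>k. (real k * y ^ k + y ^ k) ^ Suc s) \<longlonglongrightarrow> (0 + 0) ^ Suc s"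
    by (intro tendsto_power tendsto_add)
  then have lim: "(\<lambda>k. (real k * y ^ k + y ^ k) ^ Suc s) \<longlonglongrightarrow> 0" by simp
  have "(real k + 1) ^ s * x ^ k \<le> (real k * y ^ k + y ^ k) ^ Suc s" for k
  proof -
    have "(real k + 1) ^ s * x ^ k \<le> (real k + 1) ^ Suc s * x ^ k"
      using assms by (intro mult_right_mono power_increasing) auto
    also have "\<dots> = ((real k + 1) * y ^ k) ^ Suc s"
      unfolding y(3)[symmetric] power_mult_distrib by (simp only: power_mult[symmetric] mult.commute)
    finally show ?thesis by (simp only: distrib_right mult_1_left)
  qed
  then show ?thesis
    using assms by (intro tendsto_sandwich[OF _ _ tendsto_const lim]) (auto intro!: always_eventually)
qed

text \<open>Iterating the step bounds \<open>u k\<close> by a multiple of \<nu>^k, and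
  (\<nu>/\<mu>)^k decays faster than any power of k grows.\<close>

lemma growth_not_below:
  fixes u :: "nat \<Rightarrow> real"
  assumes "c > 0" "0 < \<nu>" "\<nu> < \<mu>" and lower: "\<And>k. c * \<mu> ^ k / (real k + 1) ^ s \<le> u k"
    and step: "\<forall>\<^sub>F k in sequentially. u (Suc k) \<le> \<nu> * u k"
  shows False
proof -
  obtain N where N: "\<And>k. k \<ge> N \<Longrightarrow> u (Suc k) \<le> \<nu> * u k"
    using step unfolding eventually_sequentially by blast
  have up: "u (N + k) \<le> u N * \<nu> ^ k" for k
  proof (induction k)
    case (Suc k)
    have "u (N + Suc k) \<le> \<nu> * u (N + k)" using N[of "N + k"] by simp
    also have "\<dots> \<le> \<nu> * (u N * \<nu> ^ k)" using Suc assms(2) by simp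
    finally show ?case by (simp add: mult_ac)
  qed simp
  define K where "K = u N / \<nu> ^ N"
  have "c * \<mu> ^ k \<le> K * \<nu> ^ k * (real k + 1) ^ s" if "k \<ge> N" for k
  proof -
    have "\<nu> ^ N * \<nu> ^ (k - N) = \<nu> ^ k" using that by (simp add: power_add[symmetric])
    then have "u N * \<nu> ^ (k - N) = K * \<nu> ^ k"
      using assms(2) by (simp add: K_def field_simps)
    then have "u k \<le> K * \<nu> ^ k"
      using up[of "k - N"] that by simp
    with lower[of k] have "c * \<mu> ^ k / (real k + 1) ^ s \<le> K * \<nu> ^ k" by linarith
    then show ?thesis by (simp add: divide_le_eq)
  qed
  then have "c \<le> K * ((real k + 1) ^ s * (\<nu> / \<mu>) ^ k)" if "k \<ge> N" for k
    using that assms(2,3) by (simp add: power_divide field_simps)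
  then have ev: "\<forall>\<^sub>F k in sequentially. c \<le> K * ((real k + 1) ^ s * (\<nu> / \<mu>) ^ k)"
    unfolding eventually_sequentially by blast
  have "0 < \<nu> / \<mu>" "\<nu> / \<mu> < 1" using assms by auto
  then have "(\<lambda>k. (real k + 1) ^ s * (\<nu> / \<mu>) ^ k) \<longlonglongrightarrow> 0" by (rule power_times_geometric_tendsto_0)
  then have "(\<lambda>k. K * ((real k + 1) ^ s * (\<nu> / \<mu>) ^ k)) \<longlonglongrightarrow> K * 0"
    by (intro tendsto_mult tendsto_const)
  then have "c \<le> K * 0" by (rule tendsto_lowerbound[OF _ ev]) simp
  then show False using assms(1) by simp
qed

lemma growth_not_above:
  fixes u :: "nat \<Rightarrow> real"
  assumes pos: "\<And>k. 0 < u k" and "0 < \<mu>" "\<mu> < \<nu>" and upper: "\<And>k. u k \<le> C * \<mu> ^ k"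
    and step: "\<forall>\<^sub>F k in sequentially. \<nu> * u k \<le> u (Suc k)"
  shows False
proof -
  obtain N where N: "\<And>k. k \<ge> N \<Longrightarrow> \<nu> * u k \<le> u (Suc k)"
    using step unfolding eventually_sequentially by blast
  have low: "u N * \<nu> ^ k \<le> u (N + k)" for k
  proof (induction k)
    case (Suc k)
    have "\<nu> * (u N * \<nu> ^ k) \<le> \<nu> * u (N + k)" using Suc assms(2,3) by simp
    also have "\<dots> \<le> u (N + Suc k)" using N[of "N + k"] by simp
    finally show ?case by (simp add: mult_ac)
  qed simp
  have "u N \<le> C * \<mu> ^ N * (\<mu> / \<nu>) ^ k" for k
  proof -
    have "u N * \<nu> ^ k \<le> C * \<mu> ^ N * \<mu> ^ k"
      using low[of k] upper[of "N + k"] by (simp add: power_add mult_ac)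
    then show ?thesis using assms(2,3) by (simp add: power_divide field_simps)
  qed
  moreover have "(\<lambda>k. C * \<mu> ^ N * (\<mu> / \<nu>) ^ k) \<longlonglongrightarrow> C * \<mu> ^ N * 0"
    using assms(2,3) by (intro tendsto_mult tendsto_const LIMSEQ_power_zero) simp
  ultimately have "u N \<le> C * \<mu> ^ N * 0"
    by (intro tendsto_lowerbound[where F = sequentially]) auto
  then show False using pos[of N] by simp
qed

lemma poly_map_of_rat:
  "poly (map_poly of_rat p) (of_rat x) = (of_rat (poly p x) :: 'a::field_char_0)"
  by (induction p) (simp_all add: map_poly_pCons of_rat_add of_rat_mult)

text \<open>The ratio behaves like l k^d with d the difference of the degrees. A nonzero d would
  give growth faster or slower than every exponential; with d = 0 the two-sided bounds force \<mu> =
  l, and l is rational as a quotient of leading coefficients.\<close>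

lemma rational_ratio_growth:
  fixes u :: "nat \<Rightarrow> real" and p q :: "rat poly"
  assumes "c > 0" "\<mu> > 0"
    and lower: "\<And>k. c * \<mu> ^ k / (real k + 1) ^ s \<le> u k" and upper: "\<And>k. u k \<le> C * \<mu> ^ k"
    and q: "\<And>k. k \<ge> 1 \<Longrightarrow> poly q (of_nat k) \<noteq> 0"
    and ratio: "\<And>k. k \<ge> 1 \<Longrightarrow> u (Suc k) / u k = \<bar>of_rat (poly p (of_nat k) / poly q (of_nat k))\<bar>"
  shows "\<mu> \<in> \<rat>"
proof -
  have pos: "0 < u k" for k
  proof -
    have "0 < c * \<mu> ^ k / (real k + 1) ^ s" using assms(1,2) by simp
    then show ?thesis using lower[of k] by linarith
  qed
  define P Q :: "real poly" where "P = map_poly of_rat p" and "Q = map_poly of_rat q"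
  have PQ: "poly P (real k) = of_rat (poly p (of_nat k))" "poly Q (real k) = of_rat (poly q (of_nat k))" for k
    using poly_map_of_rat[of _ "of_nat k", where 'a = real] by (simp_all add: P_def Q_def)
  define l where "l = \<bar>lead_coeff P\<bar> / \<bar>lead_coeff Q\<bar>"
  define \<rho> where "\<rho> k = \<bar>poly P (real k) / real k ^ degree P\<bar> / \<bar>poly Q (real k) / real k ^ degree Q\<bar>" for k
  have step: "u (Suc k) = \<rho> k * (real k ^ degree P / real k ^ degree Q) * u k" if "k \<ge> 1" for k
  proof -
    have "u (Suc k) / u k = \<bar>poly P (real k)\<bar> / \<bar>poly Q (real k)\<bar>"
      using ratio[OF that] by (simp add: PQ of_rat_divide)
    moreover have "poly Q (real k) \<noteq> 0" using q[OF that] by (simp add: PQ)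
    ultimately show ?thesis using pos[of k] that by (simp add: \<rho>_def field_simps)
  qed
  have "u (Suc 1) \<noteq> 0" using pos[of "Suc 1"] by simp
  then have "poly P (real 1) \<noteq> 0" using step[of 1] by (auto simp: \<rho>_def)
  then have P0: "P \<noteq> 0" by auto
  have "poly Q (real 1) \<noteq> 0" using q[of 1] PQ(2)[of 1] by simp
  then have Q0: "Q \<noteq> 0" by auto
  have l: "l > 0" using P0 Q0 by (simp add: l_def)
  have lim: "\<rho> \<longlonglongrightarrow> l"
    unfolding \<rho>_def l_def using Q0 by (intro tendsto_divide tendsto_rabs poly_div_power_tendsto) auto
  have lrat: "l \<in> \<rat>"
  proof -
    have "coeff P i \<in> \<rat>" "coeff Q i \<in> \<rat>" for i
      by (simp_all add: P_def Q_def coeff_map_poly)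
    moreover have "\<bar>x\<bar> \<in> \<rat>" if "x \<in> \<rat>" for x :: real
      using that by (cases "x \<ge> 0") auto
    ultimately show ?thesis unfolding l_def by (simp add: Rats_divide)
  qed
  have ev: "\<forall>\<^sub>F k in sequentially. k \<ge> (1::nat)" by (rule eventually_ge_at_top)
  have below: "u (Suc k) \<le> \<nu> * u k" if "k \<ge> 1" "\<rho> k * (real k ^ degree P / real k ^ degree Q) \<le> \<nu>" for k \<nu>
    unfolding step[OF that(1)] using that(2) pos[of k] by (intro mult_right_mono) auto
  have above: "\<nu> * u k \<le> u (Suc k)" if "k \<ge> 1" "\<nu> \<le> \<rho> k * (real k ^ degree P / real k ^ degree Q)" for k \<nu>
    unfolding step[OF that(1)] using that(2) pos[of k] by (intro mult_right_mono) auto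
  consider "degree P < degree Q" | "degree P > degree Q" | "degree P = degree Q" by linarith
  then show ?thesis
  proof cases
    case 1
    then have "(\<lambda>k. real k ^ degree P / real k ^ degree Q) \<longlonglongrightarrow> 0" by (rule power_quotient_tendsto_0)
    then have "(\<lambda>k. \<rho> k * (real k ^ degree P / real k ^ degree Q)) \<longlonglongrightarrow> l * 0"
      by (intro tendsto_mult lim)
    then have "\<forall>\<^sub>F k in sequentially. \<rho> k * (real k ^ degree P / real k ^ degree Q) < \<mu> / 2"
      using assms(2) by (intro order_tendstoD) auto
    with ev have "\<forall>\<^sub>F k in sequentially. u (Suc k) \<le> \<mu> / 2 * u k"
      by eventually_elim (rule below, simp_all only: less_imp_le)
    then have False using growth_not_below[of c "\<mu> / 2" \<mu> s u] assms(1,2) lower by simp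
    then show ?thesis ..
  next
    case 2
    then have "real k \<le> real k ^ degree P / real k ^ degree Q" if "k \<ge> 1" for k
      using power_increasing[of 1 "degree P - degree Q" "real k"] that
      by (simp add: power_diff)
    with ev have "\<forall>\<^sub>F k in sequentially. real k \<le> real k ^ degree P / real k ^ degree Q"
      by (rule eventually_mono)
    then have "filterlim (\<lambda>k. real k ^ degree P / real k ^ degree Q) at_top sequentially"
      by (rule filterlim_at_top_mono[OF filterlim_real_sequentially])
    then have "filterlim (\<lambda>k. \<rho> k * (real k ^ degree P / real k ^ degree Q)) at_top sequentially"
      by (rule filterlim_tendsto_pos_mult_at_top[OF lim l])
    then have "\<forall>\<^sub>F k in sequentially. 2 * \<mu> \<le> \<rho> k * (real k ^ degree P / real k ^ degree Q)"
      by (simp add: filterlim_at_top)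
    with ev have "\<forall>\<^sub>F k in sequentially. 2 * \<mu> * u k \<le> u (Suc k)"
      by eventually_elim (rule above)
    then have False using growth_not_above[of u \<mu> "2 * \<mu>" C] assms(1,2) pos upper by simp
    then show ?thesis ..
  next
    case 3
    have one: "\<rho> k * (real k ^ degree P / real k ^ degree Q) = \<rho> k" if "k \<ge> 1" for k
      using that 3 by simp
    have "\<not> l < \<mu>"
    proof
      assume lt: "l < \<mu>"
      have "\<forall>\<^sub>F k in sequentially. \<rho> k < (l + \<mu>) / 2" using lt by (intro order_tendstoD[OF lim]) simp
      with ev have "\<forall>\<^sub>F k in sequentially. u (Suc k) \<le> (l + \<mu>) / 2 * u k"
        by eventually_elim (rule below, simp_all only: one less_imp_le)
      then show False using growth_not_below[of c "(l + \<mu>) / 2" \<mu> s u] assms(1,2) lower lt l by simp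
    qed
    moreover have "\<not> \<mu> < l"
    proof
      assume lt: "\<mu> < l"
      have "\<forall>\<^sub>F k in sequentially. (l + \<mu>) / 2 < \<rho> k" using lt by (intro order_tendstoD[OF lim]) simp
      with ev have "\<forall>\<^sub>F k in sequentially. (l + \<mu>) / 2 * u k \<le> u (Suc k)"
        by eventually_elim (rule above, simp_all only: one less_imp_le)
      then show False using growth_not_above[of u \<mu> "(l + \<mu>) / 2" C] assms(2) pos upper lt by simp
    qed
    ultimately have "\<mu> = l" by simp
    then show ?thesis using lrat by simp
  qed
qed

section \<open>Irrationality of the growth rate\<close>

lemma map_poly_of_rat_mult:
  "map_poly of_rat (p * q) = map_poly of_rat p * (map_poly of_rat q :: 'a::field_char_0 poly)"
  by (rule poly_eqI) (simp add: coeff_map_poly coeff_mult of_rat_sum of_rat_mult)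

lemma map_poly_of_rat_add:
  "map_poly of_rat (p + q) = map_poly of_rat p + (map_poly of_rat q :: 'a::field_char_0 poly)"
  by (rule poly_eqI) (simp add: coeff_map_poly of_rat_add)

lemma of_real_of_rat: "of_real (of_rat x) = (of_rat x :: 'a::real_field)"
  by (cases x) (simp add: of_rat_rat)

section \<open>Cosines as algebraic integers\<close>

text \<open>Recursion 2 cos((k+1)\<phi>) = 2 cos(\<phi>) 2 cos(k\<phi>) - 2 cos((k-1)\<phi>). The
  leading power is split off, so that being monic becomes the degree bound on \<open>r\<close>. At k
  = 0 the remainder would be 1, whose degree is not below 0; hence k = 1 and k = 2 are both base
  cases.\<close>

lemma chebyshev_monic:
  "k \<ge> 1 \<Longrightarrow> \<exists>r :: real poly. degree r < k \<and> (\<forall>i. coeff r i \<in> \<int>) \<and>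
     (\<forall>\<phi>. poly r (2 * cos \<phi>) + (2 * cos \<phi>) ^ k = 2 * cos (real k * \<phi>))"
proof (induction k rule: less_induct)
  case (less k)
  consider "k = 1" | "k = 2" | l where "k = Suc (Suc l)" "l \<ge> 1"
    using less.prems by (metis One_nat_def Suc_1 Suc_le_eq gr0_conv_Suc le_neq_implies_less not0_implies_Suc)
  then show ?case
  proof cases
    case 1
    then show ?thesis by (intro exI[of _ 0]) simp
  next
    case 2
    have "poly [:-2:] (2 * cos \<phi>) + (2 * cos \<phi>) ^ 2 = 2 * cos (real 2 * \<phi>)" for \<phi> :: real
      using cos_double_cos[of \<phi>] by (simp add: power_mult_distrib)
    then show ?thesis using 2 by (intro exI[of _ "[:-2:]"]) (auto simp: coeff_pCons split: nat.splits)
  next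
    case (3 l)
    obtain r where r: "degree r < Suc l" "\<forall>i. coeff r i \<in> \<int>"
      "\<forall>\<phi>. poly r (2 * cos \<phi>) + (2 * cos \<phi>) ^ Suc l = 2 * cos (real (Suc l) * \<phi>)"
      using less.IH[of "Suc l"] 3 by auto
    obtain t where t: "degree t < l" "\<forall>i. coeff t i \<in> \<int>"
      "\<forall>\<phi>. poly t (2 * cos \<phi>) + (2 * cos \<phi>) ^ l = 2 * cos (real l * \<phi>)"
      using less.IH[of l] 3 by auto
    let ?v = "pCons 0 r - (monom 1 l + t)"
    have "degree (pCons 0 r) < k" using r(1) 3 by (intro le_less_trans[OF degree_pCons_le]) auto
    moreover have "degree (monom 1 l + t) < k"
      using t(1) 3 by (intro degree_add_less le_less_trans[OF degree_monom_le]) auto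
    ultimately have "degree ?v < k" by (rule degree_diff_less)
    moreover have "\<forall>i. coeff ?v i \<in> \<int>"
      using r(2) t(2) by (auto simp: coeff_pCons split: nat.splits intro!: Ints_diff Ints_add)
    moreover have "poly ?v (2 * cos \<phi>) + (2 * cos \<phi>) ^ k = 2 * cos (real k * \<phi>)" for \<phi>
    proof -
      have "cos (real (Suc l) * \<phi> + \<phi>) + cos (real (Suc l) * \<phi> - \<phi>) = 2 * cos \<phi> * cos (real (Suc l) * \<phi>)"
        by (simp add: cos_add cos_diff)
      then have "cos (real k * \<phi>) + cos (real l * \<phi>) = 2 * cos \<phi> * cos (real (Suc l) * \<phi>)"
        by (simp add: 3(1) algebra_simps)
      then have "2 * cos (real k * \<phi>) = 2 * cos \<phi> * (2 * cos (real (Suc l) * \<phi>)) - 2 * cos (real l * \<phi>)"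
        by simp
      also have "\<dots> = 2 * cos \<phi> * (poly r (2 * cos \<phi>) + (2 * cos \<phi>) ^ Suc l)
          - (poly t (2 * cos \<phi>) + (2 * cos \<phi>) ^ l)"
        using r(3) t(3) by simp
      also have "\<dots> = poly ?v (2 * cos \<phi>) + (2 * cos \<phi>) ^ k"
        unfolding 3(1) by (simp add: poly_monom algebra_simps)
      finally show ?thesis by simp
    qed
    ultimately show ?thesis by blast
  qed
qed

text \<open>At \<phi> = pi/n the monic polynomial for 2 cos(n\<phi>) takes the value -2; adding 2
  gives the required equation.\<close>

lemma two_cos_algebraic_int:
  assumes "n \<ge> 1"
  shows "algebraic_int (2 * cos (pi / real n))"
proof -
  obtain r :: "real poly" where r: "degree r < n" "\<forall>i. coeff r i \<in> \<int>"
    "\<forall>\<phi>. poly r (2 * cos \<phi>) + (2 * cos \<phi>) ^ n = 2 * cos (real n * \<phi>)"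
    using chebyshev_monic[OF assms] by blast
  let ?v = "r + [:2:]"
  have "degree ?v < n" using r(1) assms by (intro degree_add_less) auto
  then have deg: "degree (?v + monom 1 n) = n" "lead_coeff (?v + monom 1 n) = 1"
    using r(1) by (simp_all add: degree_add_eq_right degree_monom_eq coeff_eq_0)
  show ?thesis
  proof (rule algebraic_int.intros)
    show "lead_coeff (?v + monom 1 n) = 1" by (rule deg)
    show "\<forall>i. coeff (?v + monom 1 n) i \<in> \<int>"
      using r(2) by (auto simp: coeff_pCons split: nat.splits intro!: Ints_add)
    have "real n * (pi / real n) = pi" using assms by simp
    then show "poly (?v + monom 1 n) (2 * cos (pi / real n)) = 0"
      using r(3)[rule_format, of "pi / real n"] by (simp add: poly_monom)
  qed
qed

text \<open>A rational algebraic integer is an integer, but for n >= 4 the number lies strictly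
  between 1 and 2. For n = 3 it equals 1.\<close>

lemma two_cos_irrational:
  assumes "n \<ge> 4"
  shows "2 * cos (pi / real n) \<notin> \<rat>"
proof
  assume "2 * cos (pi / real n) \<in> \<rat>"
  then have "2 * cos (pi / real n) \<in> \<int>"
    using two_cos_algebraic_int[of n] assms rational_algebraic_int_is_int by simp
  then obtain m where m: "2 * cos (pi / real n) = of_int m" by (auto elim: Ints_cases)
  have x: "0 < pi / real n" "pi / real n \<le> pi / 4" using assms by (auto simp: field_simps)
  have "cos (pi / 4) \<le> cos (pi / real n)" using x by (intro cos_monotone_0_pi_le) auto
  moreover have "1 < 2 * cos (pi / 4)" by (simp add: cos_45)
  moreover have "cos (pi / real n) < cos 0" using x pi_gt_zero by (intro cos_monotone_0_pi) linarith+
  ultimately have "1 < (of_int m :: real)" "(of_int m :: real) < 2" unfolding m[symmetric] by simp_all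
  then have "1 < m" "m < 2" by simp_all
  then show False by simp
qed

text \<open>
  With $\omega = e^{i\pi/n}$ the number in question is $-(1+\omega)^{2n}$. If it were rational,
  the common roots of $X^n + 1$ and $(1+X)^{2n} + \mu$ would be $\omega$ and its conjugate only, so
  that the greatest common divisor over the rationals would be $X^2 - 2\cos(\pi/n) X + 1$.
\<close>

lemma cos_power_irrational:
  assumes n: "n \<ge> 4"
  shows "(2 * cos (pi / (2 * real n))) ^ (2 * n) \<notin> \<rat>"
proof
  define \<theta> where "\<theta> = pi / (2 * real n)"
  assume "(2 * cos (pi / (2 * real n))) ^ (2 * n) \<in> \<rat>"
  then obtain \<mu> where \<mu>: "(2 * cos \<theta>) ^ (2 * n) = of_rat \<mu>" unfolding \<theta>_def by (auto elim: Rats_cases)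
  define \<omega> where "\<omega> = cis (2 * \<theta>)"
  have n\<theta>: "real n * (2 * \<theta>) = pi" "real (2 * n) * \<theta> = pi" using n by (simp_all add: \<theta>_def)
  have \<theta>: "0 < \<theta>" "\<theta> < pi / 2" using n by (auto simp: \<theta>_def field_simps)
  have \<omega>n: "\<omega> ^ n = -1" unfolding \<omega>_def by (simp only: DeMoivre n\<theta> cis_pi)
  \<comment> \<open>The half-angle form: raised to the power 2n, the phase of angle \<theta> becomes
    one of angle pi, that is -1.\<close>
  have "1 + \<omega> = of_real (2 * cos \<theta>) * cis \<theta>"
    using cos_double_cos[of \<theta>] sin_double[of \<theta>]
    by (simp add: \<omega>_def complex_eq_iff power2_eq_square)
  then have \<omega>2: "(1 + \<omega>) ^ (2 * n) = - of_real ((2 * cos \<theta>) ^ (2 * n))"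
    by (simp only: power_mult_distrib DeMoivre n\<theta> cis_pi of_real_power) simp
  define f h :: "rat poly" where "f = monom 1 n + 1" and "h = [:1, 1:] ^ (2 * n) + [:\<mu>:]"
  define F H :: "complex poly" where "F = map_poly of_rat f" and "H = map_poly of_rat h"
  have pow: "map_poly of_rat ([:1, 1:] ^ k) = ([:1, 1:] ^ k :: complex poly)" for k
    by (induction k) (simp_all add: map_poly_of_rat_mult map_poly_pCons del: mult_pCons_left)
  have F: "F = monom 1 n + 1"
    unfolding F_def f_def map_poly_of_rat_add by (simp add: map_poly_monom)
  have H: "H = [:1, 1:] ^ (2 * n) + [:of_rat \<mu>:]"
    unfolding H_def h_def map_poly_of_rat_add pow by (simp add: map_poly_pCons)
  have Fz: "poly F z = z ^ n + 1" and Hz: "poly H z = (1 + z) ^ (2 * n) + of_rat \<mu>" for z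
    by (simp_all add: F H poly_monom)
  have of_rat_\<mu>: "of_rat \<mu> = complex_of_real ((2 * cos \<theta>) ^ (2 * n))"
    unfolding \<mu> by (rule of_real_of_rat[symmetric])
  have root: "poly F \<omega> = 0" "poly H \<omega> = 0"
    unfolding Fz Hz by (simp_all only: \<omega>n \<omega>2 of_rat_\<mu>) simp_all
  have root': "poly F (cnj \<omega>) = 0" "poly H (cnj \<omega>) = 0"
  proof -
    have "cnj (poly F \<omega>) = poly F (cnj \<omega>)" by (simp add: Fz)
    then show "poly F (cnj \<omega>) = 0" using root(1) by simp
    have "cnj (poly H \<omega>) = poly H (cnj \<omega>)" unfolding Hz of_rat_\<mu> by simp
    then show "poly H (cnj \<omega>) = 0" using root(2) by simp
  qed
  \<comment> \<open>Taking norms, z lies on the unit circle and has the same distance from -1 as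
    \<omega>. The two circles meet only in \<omega> and its conjugate.\<close>
  have only: "z = \<omega> \<or> z = cnj \<omega>" if z: "poly F z = 0" "poly H z = 0" for z
  proof -
    have zn: "z ^ n = -1" using z(1) unfolding Fz by (simp add: add_eq_0_iff2)
    then have "norm z ^ n = 1" by (metis norm_minus_cancel norm_one norm_power)
    then have nz: "norm z = 1" using power_eq_imp_eq_base[of "norm z" n 1] n by simp
    have "(1 + z) ^ (2 * n) = - of_rat \<mu>" using z(2) unfolding Hz by (simp add: add_eq_0_iff2)
    then have "norm (1 + z) ^ (2 * n) = norm (1 + \<omega>) ^ (2 * n)"
      unfolding norm_power[symmetric] \<omega>2 of_rat_\<mu> by simp
    then have "norm (1 + z) = norm (1 + \<omega>)"
      using n by (simp add: power_eq_iff_eq_base)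
    then have "(norm (1 + z))\<^sup>2 = (norm (1 + \<omega>))\<^sup>2" by simp
    moreover have "(norm (1 + y))\<^sup>2 = 1 + 2 * Re y + (norm y)\<^sup>2" for y
      by (simp add: cmod_power2 power2_sum)
    ultimately have Re: "Re z = Re \<omega>" using nz by (simp add: \<omega>_def)
    have "(Re z)\<^sup>2 + (Im z)\<^sup>2 = (Re \<omega>)\<^sup>2 + (Im \<omega>)\<^sup>2"
      using nz unfolding cmod_power2[symmetric] by (simp add: \<omega>_def)
    then have "Im z = Im \<omega> \<or> Im z = - Im \<omega>" unfolding Re by (simp add: power2_eq_iff)
    then show ?thesis using Re by (auto simp: complex_eq_iff)
  qed
  define g where "g = gcd f h"
  define G :: "complex poly" where "G = map_poly of_rat g"
  \<comment> \<open>Bezout's identity over the rationals makes every common complex root of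
    \<open>F\<close> and \<open>H\<close> a root of \<open>G\<close>; divisibility gives the
    converse.\<close>
  obtain a b where ab: "bezout_coefficients f h = (a, b)" by (cases "bezout_coefficients f h")
  have "a * f + b * h = g" unfolding g_def by (rule bezout_coefficients[OF ab])
  then have G: "G = map_poly of_rat a * F + map_poly of_rat b * H"
    unfolding G_def F_def H_def by (simp add: map_poly_of_rat_add[symmetric] map_poly_of_rat_mult[symmetric])
  obtain f' h' where fh: "f = g * f'" "h = g * h'" unfolding g_def by (meson dvdE gcd_dvd1 gcd_dvd2)
  have FG: "F = G * map_poly of_rat f'" and HG: "H = G * map_poly of_rat h'"
    unfolding F_def H_def G_def fh by (simp_all only: map_poly_of_rat_mult)
  have roots: "{z. poly G z = 0} = {\<omega>, cnj \<omega>}"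
  proof (intro set_eqI iffI)
    fix z assume "z \<in> {z. poly G z = 0}"
    then have "poly F z = 0" "poly H z = 0" unfolding FG HG by simp_all
    then show "z \<in> {\<omega>, cnj \<omega>}" using only by blast
  qed (use root root' in \<open>auto simp: G\<close>)
  have dF: "poly (pderiv F) z = of_nat n * z ^ (n - 1)" for z
    by (simp add: F pderiv_add pderiv_monom poly_monom)
  \<comment> \<open>A double root of \<open>G\<close> would be a double root of X^n + 1, whose
    derivative vanishes only at 0.\<close>
  have "rsquarefree G"
    unfolding rsquarefree_roots
  proof (intro allI notI)
    fix z assume z: "poly G z = 0 \<and> poly (pderiv G) z = 0"
    then have "poly F z = 0" "poly (pderiv F) z = 0" unfolding FG by (simp_all add: pderiv_mult)
    then have "z ^ n = -1" "z = 0" using n by (auto simp: Fz dF add_eq_0_iff2)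
    then show False using n by (simp add: power_0_left)
  qed
  then have "smult (lead_coeff G) (\<Prod>z|poly G z = 0. [:-z, 1:]) = G"
    by (rule complex_poly_decompose_rsquarefree)
  moreover have "Im \<omega> > 0" using \<theta> by (simp add: \<omega>_def sin_gt_zero)
  then have "\<omega> \<noteq> cnj \<omega>" by (auto simp: complex_eq_iff)
  ultimately have Gq: "G = smult (lead_coeff G) ([:-\<omega>, 1:] * [:-cnj \<omega>, 1:])"
    unfolding roots by simp
  have "G \<noteq> 0" using \<open>rsquarefree G\<close> by (simp add: rsquarefree_def)
  then have lc: "lead_coeff G \<noteq> 0" by simp
  \<comment> \<open>The linear coefficient, divided by the leading one, is minus the sum of the two
    roots. Since \<open>G\<close> comes from a rational polynomial, that sum is rational.\<close>
  have "coeff G 1 = lead_coeff G * coeff ([:-\<omega>, 1:] * [:-cnj \<omega>, 1:]) 1"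
    using arg_cong[OF Gq, of "\<lambda>p. coeff p 1"] by simp
  also have "coeff ([:-\<omega>, 1:] * [:-cnj \<omega>, 1:]) 1 = - (\<omega> + cnj \<omega>)" by simp
  also have "\<omega> + cnj \<omega> = of_real (2 * cos (2 * \<theta>))" by (simp add: \<omega>_def complex_eq_iff)
  finally have "complex_of_real (2 * cos (2 * \<theta>)) = - coeff G 1 / lead_coeff G"
    using lc by (simp add: field_simps)
  also have "\<dots> = of_rat (- coeff g 1 / coeff g (degree G))"
    by (simp add: G_def coeff_map_poly of_rat_divide of_rat_minus)
  also have "\<dots> = of_real (of_rat (- coeff g 1 / coeff g (degree G)))"
    by (rule of_real_of_rat[symmetric])
  finally have "2 * cos (2 * \<theta>) = of_rat (- coeff g 1 / coeff g (degree G))"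
    unfolding of_real_eq_iff .
  then have "2 * cos (2 * \<theta>) \<in> \<rat>" by simp
  then show False using two_cos_irrational[OF n] by (simp add: \<theta>_def)
qed

section \<open>Transfer to the graph library\<close>

lemma mod_succ_inj: "j < m \<Longrightarrow> r < m \<Longrightarrow> (j + 1) mod m = (r + 1) mod m \<longleftrightarrow> j = r" for m :: nat
  by (auto simp: mod_Suc split: if_splits)

text \<open>The shift by one translates between the vertices 1, ..., m and the residues 0, ..., m -
  1, for which rotation is addition.\<close>

lemma cycle_graph_arc:
  assumes "i < m" "j < m"
  shows "(i + 1, j + 1) \<in> parcs (cycle_graph m) \<longleftrightarrow> cycle_adj m i j"
proof -
  have "(j + 1) mod m = (i + 1 + 1) mod m \<longleftrightarrow> j = (i + 1) mod m" if "i < m" "j < m" for i j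
  proof -
    have "(i + 1 + 1) mod m = ((i + 1) mod m + 1) mod m" by (simp add: mod_simps)
    then show ?thesis using that mod_succ_inj[of j m "(i + 1) mod m"] by simp
  qed
  then show ?thesis using assms by (simp add: cycle_graph_def cycle_adj_def)
qed

lemma cycle_graph_isoE:
  assumes wf: "wf_digraph H" and tail: "tail H = fst" "head H = snd"
    and iso: "digraph_iso H (with_proj (cycle_graph m))"
  obtains f where "inj_on f {..<m}" "f ` {..<m} \<subseteq> verts H"
    "\<And>i j. i < m \<Longrightarrow> j < m \<Longrightarrow> (f i, f j) \<in> arcs H \<longleftrightarrow> cycle_adj m i j"
proof -
  obtain \<phi> where \<phi>: "pre_digraph.digraph_isomorphism H \<phi>" "with_proj (cycle_graph m) = app_iso \<phi> H"
    using iso unfolding digraph_iso_def by blast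
  have V: "iso_verts \<phi> ` verts H = {1..m}"
    using arg_cong[OF \<phi>(2), of verts] by (simp add: cycle_graph_def)
  have A: "iso_arcs \<phi> ` arcs H = parcs (cycle_graph m)"
    using arg_cong[OF \<phi>(2), of arcs] by simp
  have T: "iso_tail \<phi> = fst" "iso_head \<phi> = snd"
    using arg_cong[OF \<phi>(2), of tail] arg_cong[OF \<phi>(2), of head] by simp_all
  have inj: "inj_on (iso_verts \<phi>) (verts H)"
    using \<phi>(1) by (simp add: pre_digraph.digraph_isomorphism_def)
  have arc: "iso_arcs \<phi> (a, b) = (iso_verts \<phi> a, iso_verts \<phi> b)" if "(a, b) \<in> arcs H" for a b
    using \<phi>(1) that unfolding pre_digraph.digraph_isomorphism_def T tail
    by (metis fst_conv snd_conv prod.collapse)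
  define f where "f i = the_inv_into (verts H) (iso_verts \<phi>) (i + 1)" for i
  have f: "f i \<in> verts H" "iso_verts \<phi> (f i) = i + 1" if "i < m" for i
  proof -
    have im: "i + 1 \<in> iso_verts \<phi> ` verts H" using that V by simp
    show "f i \<in> verts H" unfolding f_def by (rule the_inv_into_into[OF inj im order_refl])
    show "iso_verts \<phi> (f i) = i + 1" unfolding f_def by (rule f_the_inv_into_f[OF inj im])
  qed
  show ?thesis
  proof
    show "inj_on f {..<m}" using f(2) by (metis add_right_cancel inj_onI lessThan_iff)
    show "f ` {..<m} \<subseteq> verts H" using f(1) by blast
    fix i j assume ij: "i < m" "j < m"
    show "(f i, f j) \<in> arcs H \<longleftrightarrow> cycle_adj m i j"
      unfolding cycle_graph_arc[OF ij, symmetric]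
    proof
      assume a: "(f i, f j) \<in> arcs H"
      then have "iso_arcs \<phi> (f i, f j) = (i + 1, j + 1)" using arc f ij by simp
      then show "(i + 1, j + 1) \<in> parcs (cycle_graph m)" using a unfolding A[symmetric] by (metis imageI)
    next
      assume "(i + 1, j + 1) \<in> parcs (cycle_graph m)"
      then obtain a b where ab: "(a, b) \<in> arcs H" "iso_arcs \<phi> (a, b) = (i + 1, j + 1)"
        unfolding A[symmetric] by auto
      have "a \<in> verts H" "b \<in> verts H"
        using wf_digraph.tail_in_verts[OF wf ab(1)] wf_digraph.head_in_verts[OF wf ab(1)] by (simp_all add: tail)
      moreover have "iso_verts \<phi> a = i + 1" "iso_verts \<phi> b = j + 1" using ab arc by auto
      ultimately have "a = f i" "b = f j" using f ij inj by (metis inj_onD)+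
      then show "(f i, f j) \<in> arcs H" using ab by simp
    qed
  qed
qed

lemma cycle_graph_isoI:
  assumes wf: "wf_digraph H" and tail: "tail H = fst" "head H = snd"
    and f: "inj_on f {..<m}" "verts H = f ` {..<m}"
    "\<And>i j. i < m \<Longrightarrow> j < m \<Longrightarrow> (f i, f j) \<in> arcs H \<longleftrightarrow> cycle_adj m i j"
  shows "digraph_iso H (with_proj (cycle_graph m))"
proof -
  define g where "g x = the_inv_into {..<m} f x + 1" for x
  have g: "g (f i) = i + 1" if "i < m" for i
    using the_inv_into_f_f[OF f(1), of i] that by (simp add: g_def)
  have arcs: "arcs H = {(f i, f j) | i j. i < m \<and> j < m \<and> cycle_adj m i j}"
  proof (intro set_eqI iffI)
    fix e assume e: "e \<in> arcs H"
    obtain i j where "fst e = f i" "snd e = f j" "i < m" "j < m"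
      using wf_digraph.tail_in_verts[OF wf e] wf_digraph.head_in_verts[OF wf e] by (auto simp: tail f(2))
    then have "e = (f i, f j)" by (simp add: prod_eq_iff)
    then show "e \<in> {(f i, f j) | i j. i < m \<and> j < m \<and> cycle_adj m i j}"
      using e f(3) \<open>i < m\<close> \<open>j < m\<close> by blast
  qed (use f(3) in blast)
  define \<phi> where "\<phi> = \<lparr> iso_verts = g, iso_arcs = map_prod g g, iso_head = snd, iso_tail = fst \<rparr>"
  have inj: "inj_on g (verts H)"
    unfolding f(2) using g by (intro inj_onI) auto
  have "arcs H \<subseteq> verts H \<times> verts H" unfolding arcs f(2) by auto
  then have "inj_on (map_prod g g) (arcs H)"
    using map_prod_inj_on[OF inj inj] inj_on_subset by blast
  then have "pre_digraph.digraph_isomorphism H \<phi>"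
    using wf inj by (simp add: pre_digraph.digraph_isomorphism_def \<phi>_def tail)
  moreover have "with_proj (cycle_graph m) = app_iso \<phi> H"
  proof (rule pre_digraph.equality)
    have "g ` f ` {..<m} = {1..m}"
    proof
      show "{1..m} \<subseteq> g ` f ` {..<m}"
      proof
        fix x assume "x \<in> {1..m}"
        then have "x = g (f (x - 1))" "x - 1 \<in> {..<m}" using g[of "x - 1"] by auto
        then show "x \<in> g ` f ` {..<m}" by blast
      qed
    qed (use g in auto)
    then show "verts (with_proj (cycle_graph m)) = verts (app_iso \<phi> H)"
      by (simp add: \<phi>_def cycle_graph_def f(2))
    have "parcs (cycle_graph m) = map_prod g g ` arcs H"
    proof (intro set_eqI iffI)
      fix e assume e: "e \<in> parcs (cycle_graph m)"
      define i j where "i = fst e - 1" and "j = snd e - 1"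
      have ij: "i < m" "j < m" "e = (i + 1, j + 1)" using e by (auto simp: cycle_graph_def i_def j_def)
      then have "(f i, f j) \<in> arcs H" using e f(3) cycle_graph_arc by blast
      moreover have "e = map_prod g g (f i, f j)" using ij g by simp
      ultimately show "e \<in> map_prod g g ` arcs H" by blast
    next
      fix e assume "e \<in> map_prod g g ` arcs H"
      then obtain i j where "i < m" "j < m" "cycle_adj m i j" "e = (i + 1, j + 1)"
        unfolding arcs using g by auto
      then show "e \<in> parcs (cycle_graph m)" using cycle_graph_arc by blast
    qed
    then show "arcs (with_proj (cycle_graph m)) = arcs (app_iso \<phi> H)" by (simp add: \<phi>_def)
  qed (simp_all add: \<phi>_def)
  ultimately show ?thesis unfolding digraph_iso_def by blast
qed

lemma chordal_iff_chordal_on: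
  assumes "pair_graph G"
  shows "chordal G \<longleftrightarrow> chordal_on (\<lambda>x y. (x, y) \<in> parcs G) (pverts G)"
proof -
  interpret pair_graph G by fact
  have wfG: "wf_digraph (with_proj G)" ..
  have "(\<exists>H. induced_subgraph H (with_proj G) \<and> digraph_iso H (with_proj (cycle_graph m)))
      \<longleftrightarrow> (\<exists>f. induced_cycle (\<lambda>x y. (x, y) \<in> parcs G) (pverts G) m f)" for m
  proof
    assume "\<exists>H. induced_subgraph H (with_proj G) \<and> digraph_iso H (with_proj (cycle_graph m))"
    then obtain H where H: "induced_subgraph H (with_proj G)" "digraph_iso H (with_proj (cycle_graph m))"
      by blast
    have sub: "wf_digraph H" "verts H \<subseteq> pverts G" "tail H = fst" "head H = snd"
      using H(1) by (simp_all add: induced_subgraph_def subgraph_def compatible_def)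
    have arcs: "arcs H = {e \<in> parcs G. fst e \<in> verts H \<and> snd e \<in> verts H}"
      using H(1) by (simp add: induced_subgraph_def)
    obtain f where f: "inj_on f {..<m}" "f ` {..<m} \<subseteq> verts H"
      "\<And>i j. i < m \<Longrightarrow> j < m \<Longrightarrow> (f i, f j) \<in> arcs H \<longleftrightarrow> cycle_adj m i j"
      using cycle_graph_isoE[OF sub(1,3,4) H(2)] by blast
    have "(f i, f j) \<in> parcs G \<longleftrightarrow> cycle_adj m i j" if "i < m" "j < m" for i j
      using f(2) f(3)[OF that] that unfolding arcs by auto
    then have "induced_cycle (\<lambda>x y. (x, y) \<in> parcs G) (pverts G) m f"
      using f(1,2) sub(2) unfolding induced_cycle_def by auto
    then show "\<exists>f. induced_cycle (\<lambda>x y. (x, y) \<in> parcs G) (pverts G) m f" by blast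
  next
    assume "\<exists>f. induced_cycle (\<lambda>x y. (x, y) \<in> parcs G) (pverts G) m f"
    then obtain f where f: "inj_on f {..<m}" "f ` {..<m} \<subseteq> pverts G"
      "\<And>i j. i < m \<Longrightarrow> j < m \<Longrightarrow> (f i, f j) \<in> parcs G \<longleftrightarrow> cycle_adj m i j"
      unfolding induced_cycle_def by blast
    let ?H = "with_proj G \<restriction> (f ` {..<m})"
    have "induced_subgraph ?H (with_proj G)"
      by (rule wf_digraph.induced_induce[OF wfG]) (use f(2) in simp)
    moreover have "digraph_iso ?H (with_proj (cycle_graph m))"
    proof (rule cycle_graph_isoI)
      show "wf_digraph ?H" by (rule wf_digraph.wellformed_induce_subgraph[OF wfG])
    qed (use f in auto)
    ultimately show "\<exists>H. induced_subgraph H (with_proj G) \<and> digraph_iso H (with_proj (cycle_graph m))"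
      by blast
  qed
  then show ?thesis unfolding chordal_def chordal_on_def by simp
qed

lemma independence_poly_eq: "independence_poly G = indep_poly (\<lambda>x y. (x, y) \<in> parcs G) (pverts G)"
proof -
  have "independent_sets G = indep (\<lambda>x y. (x, y) \<in> parcs G) (pverts G)"
    by (auto simp: independent_sets_def indep_def)
  then show ?thesis by (simp add: independence_poly_def indep_poly_def)
qed

section \<open>Restriction to an induced cycle\<close>

definition embed :: "(nat \<Rightarrow> 'v) \<Rightarrow> nat \<Rightarrow> (nat \<Rightarrow> nat) \<Rightarrow> 'v \<Rightarrow>\<^sub>0 nat" where
  "embed f n a = (\<Sum>i<n. Poly_Mapping.single (f i) (a i))"

lemma lookup_embed:
  assumes "inj_on f {..<n}"
  shows "i < n \<Longrightarrow> Poly_Mapping.lookup (embed f n a) (f i) = a i"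
    "x \<notin> f ` {..<n} \<Longrightarrow> Poly_Mapping.lookup (embed f n a) x = 0"
proof -
  have eq: "Poly_Mapping.lookup (embed f n a) x = (\<Sum>i<n. if f i = x then a i else 0)" for x
    unfolding embed_def by (simp add: lookup_sum lookup_single when_def)
  show "Poly_Mapping.lookup (embed f n a) (f i) = a i" if "i < n"
  proof -
    have "(\<Sum>j<n. if f j = f i then a j else 0) = (\<Sum>j<n. if j = i then a j else 0)"
      using assms that by (intro sum.cong) (auto dest: inj_onD)
    then show ?thesis using that by (simp add: eq)
  qed
  show "Poly_Mapping.lookup (embed f n a) x = 0" if "x \<notin> f ` {..<n}"
    unfolding eq using that by (intro sum.neutral) auto
qed

lemma embed_minus_ind_exp:
  assumes "inj_on f {..<n}" "S \<subseteq> {..<n}"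
  shows "embed f n a - ind_exp (f ` S) = embed f n (dec a S)"
proof (rule poly_mapping_eqI)
  fix x
  have "finite (f ` S)" using assms(2) finite_subset by blast
  moreover have "f i \<in> f ` S \<longleftrightarrow> i \<in> S" if "i < n" for i
    using assms that by (auto dest: inj_onD)
  ultimately show "Poly_Mapping.lookup (embed f n a - ind_exp (f ` S)) x = Poly_Mapping.lookup (embed f n (dec a S)) x"
    using assms lookup_embed[OF assms(1)]
    by (cases "x \<in> f ` {..<n}") (auto simp: lookup_minus_ind_exp dec_def)
qed

text \<open>Embedded exponents vanish off the cycle, so only independent sets inside it survive;
  because the cycle is induced, these are the independent sets of the cycle itself.\<close>

lemma indep_supp_embed:
  assumes "induced_cycle E V n f"
  shows "indep_supp E V (Poly_Mapping.lookup (embed f n a)) = (`) f ` indep_supp (cycle_adj n) {..<n} a"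
proof (intro set_eqI iffI)
  note f = assms[unfolded induced_cycle_def]
  fix T assume T: "T \<in> indep_supp E V (Poly_Mapping.lookup (embed f n a))"
  define S where "S = {i. i < n \<and> f i \<in> T}"
  have "x \<in> f ` {..<n}" if "x \<in> T" for x
    using T that lookup_embed(2)[of f n x a] f by (fastforce simp: indep_supp_def)
  then have TS: "T = f ` S" by (auto simp: S_def)
  moreover have "S \<in> indep_supp (cycle_adj n) {..<n} a"
    using T f lookup_embed(1)[of f n] unfolding TS by (fastforce simp: indep_supp_def indep_def S_def)
  ultimately show "T \<in> (`) f ` indep_supp (cycle_adj n) {..<n} a" by blast
next
  note f = assms[unfolded induced_cycle_def]
  fix T assume "T \<in> (`) f ` indep_supp (cycle_adj n) {..<n} a"
  then obtain S where S: "T = f ` S" "S \<subseteq> {..<n}" "\<And>i j. i \<in> S \<Longrightarrow> j \<in> S \<Longrightarrow> \<not> cycle_adj n i j"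
    "\<And>i. i \<in> S \<Longrightarrow> 0 < a i"
    by (auto simp: indep_supp_def indep_def)
  then show "T \<in> indep_supp E V (Poly_Mapping.lookup (embed f n a))"
    using f lookup_embed(1)[of f n] by (auto simp: indep_supp_def indep_def subset_iff)
qed

text \<open>The coefficients supported on the cycle obey the recursion of the cycle alone. The sign
  given by the degree replaces x by -x, and the sign of \<open>card S\<close> in
  \<open>ind_sum\<close> compensates for the drop of the degree by \<open>card S\<close>.\<close>

lemma inv_coeffs_cycle:
  assumes "finite V" "n \<ge> 2" and f: "induced_cycle E V n f"
  defines "c \<equiv> mcoeff (inverse (indep_poly E V))"
  shows "inv_coeffs (cycle_adj n) {..<n} (\<lambda>a. of_rat ((-1) ^ (sum a {..<n}) * c (embed f n a)))"
    (is "inv_coeffs _ _ ?D")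
proof -
  have inj: "inj_on f {..<n}" using f by (simp add: induced_cycle_def)
  have "ind_sum (cycle_adj n) {..<n} ?D a = (if a = (\<lambda>_. 0) then 1 else 0)" if a: "supp a \<subseteq> {..<n}" for a
  proof -
    let ?I = "indep_supp (cycle_adj n) {..<n} a"
    have "(-1) ^ card S * ?D (dec a S) = of_rat ((-1) ^ (sum a {..<n}) * c (embed f n (dec a S)))"
      if S: "S \<in> ?I" for S
    proof -
      have sub: "S \<subseteq> {..<n}" "\<And>i. i \<in> S \<Longrightarrow> 0 < a i" using S by (auto simp: indep_supp_def indep_def)
      have "(\<Sum>i<n. a i) = (\<Sum>i<n. dec a S i + (if i \<in> S then 1 else 0))"
        using sub by (intro sum.cong) (auto simp: dec_def)
      also have "\<dots> = sum (dec a S) {..<n} + card ({..<n} \<inter> S)"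
        by (simp add: sum.distrib sum.If_cases)
      also have "{..<n} \<inter> S = S" using sub by blast
      finally show ?thesis by (simp add: power_add of_rat_mult of_rat_power)
    qed
    then have "ind_sum (cycle_adj n) {..<n} ?D a =
        of_rat ((-1) ^ (sum a {..<n}) * (\<Sum>S\<in>?I. c (embed f n (dec a S))))"
      unfolding ind_sum_def by (simp add: sum_distrib_left of_rat_sum)
    also have "(\<Sum>S\<in>?I. c (embed f n (dec a S))) =
        (\<Sum>T\<in>indep_supp E V (Poly_Mapping.lookup (embed f n a)). c (embed f n a - ind_exp T))"
    proof -
      have "inj_on ((`) f) ?I"
        using inj_on_image_Pow[OF inj] by (rule inj_on_subset) (auto simp: indep_supp_def indep_def)
      then show ?thesis
        unfolding indep_supp_embed[OF f]
        by (subst sum.reindex)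
           (auto intro!: sum.cong simp: embed_minus_ind_exp[OF inj] indep_supp_def indep_def)
    qed
    also have "\<dots> = mcoeff 1 (embed f n a)"
      unfolding c_def mcoeff_indep_poly_times[OF assms(1), symmetric] indep_poly_inverse[OF assms(1)] ..
    also have "\<dots> = (if a = (\<lambda>_. 0) then 1 else 0)"
    proof -
      have "embed f n a = 0 \<longleftrightarrow> a = (\<lambda>_. 0)"
      proof
        assume 0: "embed f n a = 0"
        have "a i = 0" for i
          using lookup_embed(1)[OF inj, of i a] 0 a by (cases "i < n") (auto simp: supp_def)
        then show "a = (\<lambda>_. 0)" by auto
      qed (simp add: embed_def)
      then show ?thesis by (simp add: one_mfps.rep_eq)
    qed
    finally show ?thesis by simp
  qed
  then show ?thesis
    using assms(2) cycle_adj_sym cycle_adj_irrefl unfolding inv_coeffs_def by blast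
qed

text \<open>Along a curve with polynomial coordinates a multivariate polynomial becomes a univariate
  one.\<close>

lemma mpoly_eval_line:
  "mpoly_eval P (\<lambda>y. poly (l y) t) =
    poly (\<Sum>a\<in>Poly_Mapping.keys P. smult (Poly_Mapping.lookup P a)
      (\<Prod>j\<in>Poly_Mapping.keys a. l j ^ Poly_Mapping.lookup a j)) t"
  by (simp add: mpoly_eval_def poly_sum poly_prod)

lemma horn_chordal_on:
  assumes "finite V" and horn: "horn_hypergeometric V (inverse (indep_poly E V))"
  shows "chordal_on E V"
  unfolding chordal_on_def
proof (intro allI impI notI)
  fix n f assume n: "4 \<le> n" and f: "induced_cycle E V n f"
  define c where "c = mcoeff (inverse (indep_poly E V))"
  define D where "D a = real_of_rat ((-1) ^ (sum a {..<n}) * c (embed f n a))" for a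
  have inj: "inj_on f {..<n}" and fV: "f ` {..<n} \<subseteq> V" using f by (auto simp: induced_cycle_def)
  have D: "inv_coeffs (cycle_adj n) {..<n} D"
    unfolding D_def c_def using inv_coeffs_cycle[OF assms(1) _ f] n by simp
  define J where "J = f ` {..<n}"
  \<comment> \<open>The coordinates are raised one at a time, leading from (k,...,k) at
    \<open>i = 0\<close> to (k+1,...,k+1) at \<open>i = n\<close>. Each single step is a ratio of
    the kind governed by the Horn condition.\<close>
  define e where "e k i = embed f n (\<lambda>j. if j < i then k + 1 else k)" for k i
  have lookup_e: "Poly_Mapping.lookup (e k i) (f j) = (if j < i then k + 1 else k)" if "j < n" for k i j
    unfolding e_def using lookup_embed(1)[OF inj that] by simp
  have lookup_e': "Poly_Mapping.lookup (e k i) x = 0" if "x \<notin> J" for k i x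
    unfolding e_def using lookup_embed(2)[OF inj] that by (simp add: J_def)
  \<comment> \<open>For k >= 1 all n coordinates are positive, so one support \<open>J\<close> and
    one pair of polynomials per \<open>i\<close> serve all such k.\<close>
  have keys_e: "Poly_Mapping.keys (e k i) = J" if "k \<ge> 1" for k i
    using that lookup_e lookup_e' by (auto simp: in_keys_iff J_def) (metis not_less_zero)
  have e_step: "e k (Suc i) = e k i + Poly_Mapping.single (f i) 1" if "i < n" for k i
  proof (rule poly_mapping_eqI)
    fix x
    show "Poly_Mapping.lookup (e k (Suc i)) x = Poly_Mapping.lookup (e k i + Poly_Mapping.single (f i) 1) x"
    proof (cases "x \<in> J")
      case True
      then obtain j where j: "j < n" "x = f j" by (auto simp: J_def)
      have "f i = f j \<longleftrightarrow> i = j" using inj that j by (auto dest: inj_onD)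
      then show ?thesis
        using j lookup_e by (auto simp: lookup_add lookup_single when_def)
    next
      case False
      then have "f i \<noteq> x" using that by (auto simp: J_def)
      then show ?thesis using lookup_e' False by (simp add: lookup_add lookup_single when_def)
    qed
  qed
  have e_n: "e k n = e (Suc k) 0" for k
    unfolding e_def embed_def by (intro sum.cong) auto
  have c0: "c (e k i) \<noteq> 0" for k i
  proof -
    have "Poly_Mapping.keys (e k i) \<subseteq> V"
      using lookup_e' fV unfolding J_def[symmetric] by (metis in_keys_iff subset_iff)
    then show ?thesis using horn by (simp add: horn_hypergeometric_def c_def)
  qed
  have "\<exists>p q :: rat poly. \<forall>k\<ge>1. poly q (of_nat k) \<noteq> 0 \<and>
      c (e k (Suc i)) / c (e k i) = poly p (of_nat k) / poly q (of_nat k)" if i: "i < n" for i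
  proof -
    have "f i \<in> J" "J \<subseteq> V" using i fV by (auto simp: J_def)
    then obtain P Q where PQ: "\<And>m. Poly_Mapping.keys m = J \<Longrightarrow>
        mpoly_eval Q (\<lambda>j. of_nat (Poly_Mapping.lookup m j)) \<noteq> 0 \<and>
        c (m + Poly_Mapping.single (f i) 1) / c m =
          mpoly_eval P (\<lambda>j. of_nat (Poly_Mapping.lookup m j)) /
          mpoly_eval Q (\<lambda>j. of_nat (Poly_Mapping.lookup m j))"
      using horn unfolding horn_hypergeometric_def c_def by meson
    \<comment> \<open>Before step \<open>i\<close> the coordinates are k + 1 at the positions
      already raised and k at the others: linear polynomials in k.\<close>
    define l :: "'a \<Rightarrow> rat poly" where
      "l x = (if x \<in> J then [:if x \<in> f ` {..<i} then 1 else 0, 1:] else 0)" for x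
    have "of_nat (Poly_Mapping.lookup (e k i) x) = poly (l x) (of_nat k)" for k x
    proof (cases "x \<in> J")
      case True
      then obtain j where j: "j < n" "x = f j" by (auto simp: J_def)
      have "f j \<in> f ` {..<i} \<longleftrightarrow> j < i" using inj i j by (auto dest: inj_onD)
      then show ?thesis using True j lookup_e by (simp add: l_def)
    qed (simp add: l_def lookup_e')
    then have line: "(\<lambda>x. of_nat (Poly_Mapping.lookup (e k i) x)) = (\<lambda>x. poly (l x) (of_nat k))" for k
      by auto
    show ?thesis
      using PQ[OF keys_e[where i = i]] unfolding e_step[OF i] line mpoly_eval_line by blast
  qed
  then obtain p q :: "nat \<Rightarrow> rat poly" where pq: "\<And>i k. i < n \<Longrightarrow> k \<ge> 1 \<Longrightarrow> poly (q i) (of_nat k) \<noteq> 0 \<and>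
      c (e k (Suc i)) / c (e k i) = poly (p i) (of_nat k) / poly (q i) (of_nat k)"
    by metis
  define P Q where "P = (\<Prod>i<n. p i)" and "Q = (\<Prod>i<n. q i)"
  have Q: "poly Q (of_nat k) \<noteq> 0" if "k \<ge> 1" for k
    using pq that by (auto simp: Q_def poly_prod)
  have ratio: "c (e (Suc k) 0) / c (e k 0) = poly P (of_nat k) / poly Q (of_nat k)" if "k \<ge> 1" for k
  proof -
    have "(\<Prod>i<m. c (e k (Suc i)) / c (e k i)) = c (e k m) / c (e k 0)" for m
      using c0 by (induction m) simp_all
    then have "c (e (Suc k) 0) / c (e k 0) = (\<Prod>i<n. c (e k (Suc i)) / c (e k i))"
      by (simp add: e_n)
    also have "\<dots> = (\<Prod>i<n. poly (p i) (of_nat k) / poly (q i) (of_nat k))"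
      using pq that by (intro prod.cong) auto
    finally show ?thesis by (simp add: P_def Q_def poly_prod prod_dividef)
  qed
  define u where "u k = D (\<lambda>i. if i < n then k else 0)" for k
  \<comment> \<open>Nonnegativity of \<open>D\<close> identifies it with the absolute value, so the
    sign depending on the degree drops out of the ratios.\<close>
  have u: "u k = \<bar>of_rat (c (e k 0))\<bar>" for k
  proof -
    let ?a = "\<lambda>i. if i < n then k else 0"
    have "embed f n ?a = e k 0" unfolding e_def embed_def by (intro sum.cong) auto
    then have "\<bar>u k\<bar> = \<bar>of_rat (c (e k 0))\<bar>"
      by (simp add: u_def D_def of_rat_mult of_rat_power abs_mult power_abs)
    moreover have "0 \<le> u k"
      unfolding u_def by (rule inv_coeffs_nonneg[OF D]) (auto simp: supp_def)
    ultimately show ?thesis by simp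
  qed
  define \<mu> where "\<mu> = (2 * cos (pi / (2 * real n))) ^ (2 * n)"
  obtain K C s where KC: "K > 0" "\<And>k. K * \<mu> ^ k / (real k + 1) ^ s \<le> u k" "\<And>k. u k \<le> C * \<mu> ^ k"
    using cycle_diagonal_growth[OF n D] unfolding u_def \<mu>_def by blast
  have "cos (pi / (2 * real n)) > 0" using n by (intro cos_gt_zero) (auto simp: field_simps)
  then have "\<mu> > 0" by (simp add: \<mu>_def)
  moreover have "u (Suc k) / u k = \<bar>of_rat (poly P (of_nat k) / poly Q (of_nat k))\<bar>" if "k \<ge> 1" for k
    unfolding ratio[OF that, symmetric] u by (simp add: of_rat_divide)
  ultimately have "\<mu> \<in> \<rat>"
    using rational_ratio_growth[OF KC(1) _ KC(2,3) Q] by blast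
  then show False using cos_power_irrational[OF n] by (simp add: \<mu>_def)
qed

theorem theorem1:
  fixes G :: "nat pair_pre_digraph" and n :: nat
  assumes "pair_graph G"
    and "pverts G = {1..n}"
  shows "(chordal G \<longleftrightarrow>
           (\<forall>q::int. q \<ge> 1 \<longrightarrow> horn_hypergeometric {1..n} (independence_poly G powi (-q)))) \<and>
         ((\<forall>q::int. q \<ge> 1 \<longrightarrow> horn_hypergeometric {1..n} (independence_poly G powi (-q))) \<longleftrightarrow>
           horn_hypergeometric {1..n} (independence_poly G powi (-1)))"
proof -
  interpret pair_graph G by fact
  define E where "E = (\<lambda>x y. (x, y) \<in> parcs G)"
  have E: "E b a" if "E a b" for a b
    using that pair_sym_arcs by (auto simp: E_def symmetric_def dest: symD)
  have irr: "\<not> E a a" for a using pair_no_loops[of "(a, a)"] by (auto simp: E_def)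
  have I: "independence_poly G = indep_poly E {1..n}"
    by (simp add: independence_poly_eq E_def assms(2))
  have ch: "chordal G \<longleftrightarrow> chordal_on E {1..n}"
    using chordal_iff_chordal_on[OF assms(1)] by (simp add: E_def assms(2))
  have powi: "independence_poly G powi (- q) = inverse (indep_poly E {1..n}) ^ nat q" if "q \<ge> 1" for q
    using that by (simp add: power_int_def I)
  have "horn_hypergeometric {1..n} (independence_poly G powi (-q))" if "chordal G" "q \<ge> 1" for q
  proof -
    have "chordal_on E {1..n}" using that(1) ch by simp
    then obtain vs where vs: "set vs = {1..n}" "perfect_elimination E vs"
      using chordal_perfect_elimination[where E = E, OF finite_atLeastAtMost _ E irr] by blast
    have "inverse (indep_poly E (set vs)) ^ nat q = elim_series E vs (nat q)"
      by (rule indep_poly_inverse_power[OF vs(2) E irr])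
    moreover have "nat q \<ge> 1" using that(2) by simp
    ultimately show ?thesis
      using horn_elim_series[OF vs(2)] by (simp add: powi[OF that(2)] vs(1))
  qed
  moreover have "chordal G" if "horn_hypergeometric {1..n} (independence_poly G powi (-1))"
    unfolding ch using that powi[of 1] by (intro horn_chordal_on) simp_all
  \<comment> \<open>The remaining implication, from all q to q = 1, is a specialisation.\<close>
  ultimately show ?thesis by (meson order_refl)
qed

end
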